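(* Let $\alpha$ be a stable non-negative increasing sequence tending to infinity, and let $\Lambda_1(\beta)$ be a nuclear power series space of finite type, where $\beta$ is a non-negative increasing sequence tending to infinity. If $n\alpha_n\le\beta_n$ holds for all sufficiently large $n\in\mathbb{N}$, then, for every $\theta=(\theta_n)_{n\in\mathbb{N}_0}\in(\Lambda_\infty(\alpha))'$, the Hankel operator $H_\theta:\Lambda_\infty(\alpha)\to\Lambda_1(\beta)$ is well-defined, continuous and compact.
   Context: $\mathbb{N}=\{1,2,\dots\}$, $\mathbb{N}_0=\mathbb{N}\cup\{0\}$. For a non-negative increasing sequence $\alpha=(\alpha_n)_{n\in\mathbb{N}}$ with $\alpha_n\to\infty$, the power series space of finite type is the Fréchet space $\Lambda_1(\alpha)=\{x=(x_n)_{n\in\mathbb{N}}:\ \|x\|_k:=\sum_{n=1}^\infty|x_n|e^{-\frac1k\alpha_n}<\infty\ \text{for all }k\in\mathbb{N}\}$, and the power series space of infinite type is the Fréchet space $\Lambda_\infty(\alpha)=\{x=(x_n)_{n\in\mathbb{N}}:\ \|x\|_k:=\sum_{n=1}^\infty|x_n|e^{k\alpha_n}<\infty\ \text{for all }k\in\mathbb{N}\}$, each with the seminorms $\|\cdot\|_k$, $k\in\mathbb{N}$. The dual of the latter is identified with the sequence space $(\Lambda_\infty(\alpha))'=\{y=(y_n)_{n\in\mathbb{N}}:\ \sup_n|y_n|e^{-k\alpha_n}<\infty\ \text{for some }k\in\mathbb{N}\}$. By the Grothendieck–Pietsch criterion, $\Lambda_1(\beta)$ is nuclear if and only if for every $k\in\mathbb{N}$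 there is $l>k$ with $\sum_{n=1}^\infty e^{-\frac1k\beta_n}/e^{-\frac1l\beta_n}<\infty$. A sequence $\alpha$ is stable if $\sup_{n\in\mathbb{N}}\alpha_{2n}/\alpha_n<\infty$, i.e. there is $M$ with $\alpha_{2n}\le M\alpha_n$ for all $n$. The sequence $e_n$ has $1$ in the $n$-th place and $0$ elsewhere. A sequence $\theta=(\theta_n)_{n\in\mathbb{N}_0}$ is identified with the sequence $(\theta_{n-1})_{n\in\mathbb{N}}=(\theta_0,\theta_1,\theta_2,\dots)$ when it is said to belong to a sequence space. The Hankel operator $H_\theta:E\to F$ between such sequence spaces is given by $H_\theta e_n=(\theta_{n-1},\theta_n,\theta_{n+1},\dots)=\sum_{j=1}^\infty\theta_{j+n-2}e_j$ for $n\in\mathbb{N}$ and $H_\theta x=\sum_{n=1}^\infty x_nH_\theta e_n$ for $x=(x_n)\in E$. It is well-defined if $H_\theta e_n\in F$ for all $n$ and the series $\sum_n x_nH_\theta e_n$ converges in $F$ for every $x\in E$. A linear map $T:E\to F$ between Fréchet spaces is compact if $T(U)$ is precompact in $F$ for some neighborhood $U$ of zero in $E$. *)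

theory Defs
  imports "HOL-Analysis.Analysis"
begin

text \<open>
  Sequences indexed by the positive integers are functions on \<^typ>\<open>nat\<close> whose value at 0 is
  ignored (weights) or required to be 0 (elements of sequence spaces, so that the norms below
  are definite). The scalar field is any type of class \<^class>\<open>real_normed_field\<close> and
  \<^class>\<open>banach\<close>, that is, the real or the complex numbers.
\<close>

section \<open>Sequence spaces with a sequence of seminorms\<close>

text \<open>
  A linear space of sequences with seminorms numbered by the positive integers; the definitions
  below assume that the seminorms increase with their index, as they do for the power series
  spaces.
\<close>

record 'a seq_space =
  elems :: "(nat \<Rightarrow> 'a) set"
  snorm :: "nat \<Rightarrow> (nat \<Rightarrow> 'a) \<Rightarrow> real"

definition seq_topology :: "'a::real_normed_field seq_space \<Rightarrow> (nat \<Rightarrow> 'a) topology" where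
  "seq_topology E = topology_generated_by
     {{y \<in> elems E. snorm E k (\<lambda>n. y n - x n) < r} | k x r. 1 \<le> k \<and> x \<in> elems E \<and> 0 < r}"

definition zero_nbhd :: "'a::real_normed_field seq_space \<Rightarrow> (nat \<Rightarrow> 'a) set \<Rightarrow> bool" where
  "zero_nbhd E U \<longleftrightarrow>
     U \<subseteq> elems E \<and> (\<exists>V. openin (seq_topology E) V \<and> (\<lambda>n. 0) \<in> V \<and> V \<subseteq> U)"

definition linear_operator ::
  "'a::real_normed_field seq_space \<Rightarrow> 'a seq_space \<Rightarrow> ((nat \<Rightarrow> 'a) \<Rightarrow> (nat \<Rightarrow> 'a)) \<Rightarrow> bool" where
  "linear_operator E F T \<longleftrightarrow>
     (\<forall>x\<in>elems E. T x \<in> elems F) \<and>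
     (\<forall>x\<in>elems E. \<forall>y\<in>elems E. T (\<lambda>n. x n + y n) = (\<lambda>n. T x n + T y n)) \<and>
     (\<forall>c. \<forall>x\<in>elems E. T (\<lambda>n. c * x n) = (\<lambda>n. c * T x n))"

definition precompact_in :: "'a::real_normed_field seq_space \<Rightarrow> (nat \<Rightarrow> 'a) set \<Rightarrow> bool" where
  "precompact_in F S \<longleftrightarrow>
     S \<subseteq> elems F \<and>
     (\<forall>W. zero_nbhd F W \<longrightarrow>
        (\<exists>A. finite A \<and> A \<subseteq> elems F \<and> (\<forall>y\<in>S. \<exists>a\<in>A. (\<lambda>n. y n - a n) \<in> W)))"

definition compact_operator ::
  "'a::real_normed_field seq_space \<Rightarrow> 'a seq_space \<Rightarrow> ((nat \<Rightarrow> 'a) \<Rightarrow> (nat \<Rightarrow> 'a)) \<Rightarrow> bool" where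
  "compact_operator E F T \<longleftrightarrow>
     linear_operator E F T \<and> (\<exists>U. zero_nbhd E U \<and> precompact_in F (T ` U))"

definition linear_form :: "'a::real_normed_field seq_space \<Rightarrow> ((nat \<Rightarrow> 'a) \<Rightarrow> 'a) \<Rightarrow> bool" where
  "linear_form E f \<longleftrightarrow>
     (\<forall>x\<in>elems E. \<forall>y\<in>elems E. f (\<lambda>n. x n + y n) = f x + f y) \<and>
     (\<forall>c. \<forall>x\<in>elems E. f (\<lambda>n. c * x n) = c * f x)"

text \<open>
  Nuclearity in the sense of Grothendieck and Pietsch: for every \<open>k\<close> there is \<open>l\<close> such that the
  canonical map from \<open>E\<close> normed by the \<open>l\<close>-th seminorm to \<open>E\<close> normed by the \<open>k\<close>-th one is
  nuclear, i.e. \<open>x = (\<Sum>j. f j x \<cdot> y j)\<close> in the \<open>k\<close>-th seminorm, where the forms \<open>f j\<close> have dual norm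
  at most \<open>c j\<close> with respect to the \<open>l\<close>-th seminorm and \<open>(\<Sum>j. c j \<cdot> snorm E k (y j)) < \<infinity>\<close>.
  Passing to completed local Banach spaces gives the same notion, by density.
\<close>

definition nuclear_space :: "'a::real_normed_field seq_space \<Rightarrow> bool" where
  "nuclear_space E \<longleftrightarrow>
     (\<forall>k\<ge>1. \<exists>l\<ge>1. \<exists>f y c.
        (\<forall>j::nat. linear_form E (f j) \<and> y j \<in> elems E \<and> 0 \<le> c j \<and>
             (\<forall>x\<in>elems E. norm (f j x) \<le> c j * snorm E l x)) \<and>
        summable (\<lambda>j. c j * snorm E k (y j)) \<and>
        (\<forall>x\<in>elems E. (\<lambda>N. snorm E k (\<lambda>n. x n - (\<Sum>j<N. f j x * y j n))) \<longlonglongrightarrow> 0))"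

section \<open>Power series spaces\<close>

definition weighted_space :: "(nat \<Rightarrow> nat \<Rightarrow> real) \<Rightarrow> 'a::real_normed_field seq_space" where
  "weighted_space w =
     \<lparr>elems = {x. x 0 = 0 \<and> (\<forall>k\<ge>1. (\<lambda>n. norm (x n) * w k n) summable_on {1..})},
      snorm = (\<lambda>k x. \<Sum>\<^sub>\<infinity>n\<in>{1..}. norm (x n) * w k n)\<rparr>"

definition Lambda_fin :: "(nat \<Rightarrow> real) \<Rightarrow> 'a::real_normed_field seq_space" where
  "Lambda_fin \<alpha> = weighted_space (\<lambda>k n. exp (- (1 / real k) * \<alpha> n))"

definition Lambda_inf :: "(nat \<Rightarrow> real) \<Rightarrow> 'a::real_normed_field seq_space" where
  "Lambda_inf \<alpha> = weighted_space (\<lambda>k n. exp (real k * \<alpha> n))"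

definition Lambda_inf_dual :: "(nat \<Rightarrow> real) \<Rightarrow> (nat \<Rightarrow> 'a::real_normed_field) set" where
  "Lambda_inf_dual \<alpha> =
     {y. y 0 = 0 \<and> (\<exists>k\<ge>1. bdd_above ((\<lambda>n. norm (y n) * exp (- real k * \<alpha> n)) ` {1..}))}"

definition exponent_sequence :: "(nat \<Rightarrow> real) \<Rightarrow> bool" where
  "exponent_sequence \<alpha> \<longleftrightarrow>
     (\<forall>n\<ge>1. 0 \<le> \<alpha> n) \<and> mono_on {1..} \<alpha> \<and> filterlim \<alpha> at_top sequentially"

definition stable_sequence :: "(nat \<Rightarrow> real) \<Rightarrow> bool" where
  "stable_sequence \<alpha> \<longleftrightarrow> (\<exists>M. \<forall>n\<ge>1. \<alpha> (2 * n) \<le> M * \<alpha> n)"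

section \<open>Hankel operators\<close>

text \<open>Identifies a sequence indexed from 0 with one indexed from 1.\<close>

definition shift_seq :: "(nat \<Rightarrow> 'a::zero) \<Rightarrow> nat \<Rightarrow> 'a" where
  "shift_seq \<theta> = (\<lambda>n. if n = 0 then 0 else \<theta> (n - 1))"

text \<open>The image of the unit sequence at \<open>n\<close>; used for \<open>n \<ge> 1\<close> only, so no subtraction truncates.\<close>

definition hankel_unit :: "(nat \<Rightarrow> 'a::zero) \<Rightarrow> nat \<Rightarrow> nat \<Rightarrow> 'a" where
  "hankel_unit \<theta> n = (\<lambda>j. if j = 0 then 0 else \<theta> (j + n - 2))"

definition hankel_partial ::
  "(nat \<Rightarrow> 'a::real_normed_field) \<Rightarrow> (nat \<Rightarrow> 'a) \<Rightarrow> nat \<Rightarrow> nat \<Rightarrow> 'a" where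
  "hankel_partial \<theta> x N = (\<lambda>j. \<Sum>n=1..N. x n * hankel_unit \<theta> n j)"

definition hankel_well_defined ::
  "(nat \<Rightarrow> 'a::real_normed_field) \<Rightarrow> 'a seq_space \<Rightarrow> 'a seq_space \<Rightarrow> bool" where
  "hankel_well_defined \<theta> E F \<longleftrightarrow>
     (\<forall>n\<ge>1. hankel_unit \<theta> n \<in> elems F) \<and>
     (\<forall>x\<in>elems E. \<exists>y. limitin (seq_topology F) (hankel_partial \<theta> x) y sequentially)"

text \<open>The sum of the series in \<open>F\<close>, which is unique when \<open>F\<close> is Hausdorff.\<close>

definition hankel_operator ::
  "(nat \<Rightarrow> 'a::real_normed_field) \<Rightarrow> 'a seq_space \<Rightarrow> (nat \<Rightarrow> 'a) \<Rightarrow> nat \<Rightarrow> 'a" where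
  "hankel_operator \<theta> F x =
     (THE y. limitin (seq_topology F) (hankel_partial \<theta> x) y sequentially)"

section \<open>The Grothendieck--Pietsch criterion\<close>

lemma bij_betw_Suc_atLeast1: "bij_betw Suc UNIV {1..}"
  by (rule bij_betwI[of _ _ _ "\<lambda>n. n - 1"]) auto

lemma nonneg_atLeast1_summable:
  fixes f :: "nat \<Rightarrow> real"
  assumes "\<And>n. 0 \<le> f n"
  shows "f summable_on {1..} \<longleftrightarrow> summable (\<lambda>n. f (Suc n))"
proof -
  have "f summable_on {1..} \<longleftrightarrow> (\<lambda>n. f (Suc n)) summable_on UNIV"
    by (rule summable_on_reindex_bij_betw[OF bij_betw_Suc_atLeast1, symmetric])
  also have "\<dots> \<longleftrightarrow> summable (\<lambda>n. f (Suc n))"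
    using assms by (rule summable_on_UNIV_nonneg_real_iff)
  finally show ?thesis .
qed

lemma nonneg_atLeast1_infsum:
  fixes f :: "nat \<Rightarrow> real"
  assumes "f summable_on {1..}"
  shows "infsum f {1..} = (\<Sum>n. f (Suc n))"
proof -
  have "(\<lambda>n. f (Suc n)) summable_on UNIV"
    using assms by (rule summable_on_reindex_bij_betw[OF bij_betw_Suc_atLeast1, THEN iffD2])
  then have "(\<lambda>n. f (Suc n)) sums infsum (\<lambda>n. f (Suc n)) UNIV"
    by (intro has_sum_imp_sums has_sum_infsum)
  moreover have "infsum (\<lambda>n. f (Suc n)) UNIV = infsum f {1..}"
    by (rule infsum_reindex_bij_betw[OF bij_betw_Suc_atLeast1])
  ultimately show ?thesis by (simp add: sums_iff)
qed

context
  fixes w :: "nat \<Rightarrow> nat \<Rightarrow> real" and W :: "'a::real_normed_field seq_space"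
  assumes w_pos: "\<And>k n. 0 < w k n"
  defines "W \<equiv> weighted_space w"
begin

lemma weighted_term_le:
  assumes "x \<in> elems W" "1 \<le> k" "finite A" "A \<subseteq> {1..}"
  shows "(\<Sum>n\<in>A. norm (x n) * w k n) \<le> snorm W k x"
  using assms w_pos
  by (auto simp: W_def weighted_space_def less_imp_le intro!: finite_sum_le_infsum)

lemma weighted_unit:
  assumes "1 \<le> m"
  shows "(\<lambda>n. if n = m then c else 0) \<in> elems W"
    and "snorm W k (\<lambda>n. if n = m then c else 0) = norm c * w k m"
proof -
  have *: "(\<lambda>n. norm (if n = m then c else 0) * w k n) = (\<lambda>n. if n = m then norm c * w k m else 0)" for k
    by auto
  have "((\<lambda>n. if n = m then norm c * w k m else 0) has_sum (norm c * w k m)) {1..}" for k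
    using assms by (intro has_sum_finite_neutralI[of "{m}"]) auto
  then show "(\<lambda>n. if n = m then c else 0) \<in> elems W"
    and "snorm W k (\<lambda>n. if n = m then c else 0) = norm c * w k m"
    using assms unfolding W_def weighted_space_def seq_space.simps mem_Collect_eq *
    by (auto intro: has_sum_imp_summable infsumI)
qed

lemma weighted_diff:
  assumes "x \<in> elems W" "y \<in> elems W"
  shows "(\<lambda>n. x n - c * y n) \<in> elems W"
proof -
  have "(\<lambda>n. norm (x n - c * y n) * w k n) summable_on {1..}" if "1 \<le> k" for k
  proof (rule summable_on_comparison_test)
    show "(\<lambda>n. norm (x n) * w k n + norm c * (norm (y n) * w k n)) summable_on {1..}"
      using assms that unfolding W_def weighted_space_def
      by (intro summable_on_add summable_on_cmult_right) auto
    show "norm (x n - c * y n) * w k n \<le> norm (x n) * w k n + norm c * (norm (y n) * w k n)" for n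
      using mult_right_mono[OF norm_triangle_ineq4[of "x n" "c * y n"], of "w k n"] w_pos[of k n]
      by (simp add: norm_mult algebra_simps)
  qed (use w_pos in \<open>auto simp: less_imp_le\<close>)
  then show ?thesis using assms unfolding W_def weighted_space_def by auto
qed

lemma weighted_diff_sum:
  assumes "x \<in> elems W" "\<And>j. y j \<in> elems W"
  shows "(\<lambda>n. x n - (\<Sum>j<(N::nat). c j * y j n)) \<in> elems W"
proof (induction N)
  case 0
  then show ?case using assms by simp
next
  case (Suc N)
  from weighted_diff[OF this assms(2), of "c N" N] show ?case
    by (simp add: diff_diff_eq)
qed

lemma nuclear_weighted_imp:
  assumes nuc: "nuclear_space W" and k: "1 \<le> k"
  obtains l where "1 \<le> l" "(\<lambda>n. w k n / w l n) summable_on {1..}"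
proof -
  from nuc[unfolded nuclear_space_def, rule_format, OF k] obtain l f y c where l: "1 \<le> l"
    and *: "\<forall>j::nat. linear_form W (f j) \<and> y j \<in> elems W \<and> 0 \<le> c j \<and>
             (\<forall>x\<in>elems W. norm (f j x) \<le> c j * snorm W l x)"
    and s: "summable (\<lambda>j. c j * snorm W k (y j))"
    and **: "\<forall>x\<in>elems W. (\<lambda>N. snorm W k (\<lambda>n. x n - (\<Sum>j<N. f j x * y j n))) \<longlonglongrightarrow> 0"
    by (elim exE conjE) (rule that)
  from * have y: "\<And>j::nat. y j \<in> elems W" and c: "\<And>j. 0 \<le> c j"
    and f: "\<And>j x. x \<in> elems W \<Longrightarrow> norm (f j x) \<le> c j * snorm W l x"
    by simp_all
  note lim = **[rule_format]
  define e where "e m = (\<lambda>n::nat. if n = m then (1::'a) else 0)" for m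
  define S where "S = (\<Sum>j. c j * snorm W k (y j))"
  have e: "e m \<in> elems W" "snorm W l (e m) = w l m" if "1 \<le> m" for m
    using weighted_unit[OF that, where c = 1] by (auto simp: e_def)
  have one: "(\<lambda>N. \<Sum>j<N. f j (e m) * y j m) \<longlonglongrightarrow> 1" if m: "1 \<le> m" for m
  proof -
    have le: "norm (1 - (\<Sum>j<N. f j (e m) * y j m)) \<le>
        snorm W k (\<lambda>n. e m n - (\<Sum>j<N. f j (e m) * y j n)) / w k m" for N
    proof -
      have "(\<lambda>n. e m n - (\<Sum>j<N. f j (e m) * y j n)) \<in> elems W"
        by (rule weighted_diff_sum[OF e(1)[OF m] y])
      from weighted_term_le[OF this k, of "{m}"] m
      have "norm (e m m - (\<Sum>j<N. f j (e m) * y j m)) * w k m \<le>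
          snorm W k (\<lambda>n. e m n - (\<Sum>j<N. f j (e m) * y j n))"
        by simp
      moreover have "e m m = 1" by (simp add: e_def)
      ultimately show ?thesis using w_pos[of k m] by (simp only: pos_le_divide_eq)
    qed
    have lim0: "(\<lambda>N. snorm W k (\<lambda>n. e m n - (\<Sum>j<N. f j (e m) * y j n)) / w k m) \<longlonglongrightarrow> 0"
      using tendsto_divide[OF lim[OF e(1)[OF m]] tendsto_const[of "w k m"]] w_pos[of k m] by simp
    have "(\<lambda>N. 1 - (\<Sum>j<N. f j (e m) * y j m)) \<longlonglongrightarrow> 0"
      by (rule Lim_null_comparison[OF always_eventually[OF allI[OF le]] lim0])
    from tendsto_diff[OF tendsto_const[of 1] this] show ?thesis by simp
  qed
  have bound: "(\<Sum>m\<in>A. w k m / w l m) \<le> S" if A: "finite A" "A \<subseteq> {1..}" for A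
  proof (rule LIMSEQ_le_const2)
    have "(\<lambda>N. \<Sum>m\<in>A. w k m / w l m * norm (\<Sum>j<N. f j (e m) * y j m)) \<longlonglongrightarrow>
        (\<Sum>m\<in>A. w k m / w l m * norm (1::'a))"
      using A by (intro tendsto_sum tendsto_mult tendsto_const tendsto_norm one) auto
    then show "(\<lambda>N. \<Sum>m\<in>A. w k m / w l m * norm (\<Sum>j<N. f j (e m) * y j m)) \<longlonglongrightarrow>
        (\<Sum>m\<in>A. w k m / w l m)" by simp
    have "(\<Sum>m\<in>A. w k m / w l m * norm (\<Sum>j<N. f j (e m) * y j m)) \<le> S" for N
    proof -
      have "w k m / w l m * norm (\<Sum>j<N. f j (e m) * y j m) \<le>
          (\<Sum>j<N. c j * (norm (y j m) * w k m))" if "m \<in> A" for m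
      proof -
        have m: "1 \<le> m" using that A by auto
        have "norm (\<Sum>j<N. f j (e m) * y j m) \<le> (\<Sum>j<N. c j * w l m * norm (y j m))"
          using f[OF e(1)[OF m]] e(2)[OF m]
          by (intro sum_norm_le) (auto simp: norm_mult intro!: mult_right_mono)
        then have "w k m / w l m * norm (\<Sum>j<N. f j (e m) * y j m) \<le>
            w k m / w l m * (\<Sum>j<N. c j * w l m * norm (y j m))"
          using w_pos by (intro mult_left_mono) (auto simp: less_imp_le)
        also have "\<dots> = (\<Sum>j<N. c j * (norm (y j m) * w k m))"
          using w_pos[of l m] by (simp add: sum_distrib_left field_simps)
        finally show ?thesis .
      qed
      then have "(\<Sum>m\<in>A. w k m / w l m * norm (\<Sum>j<N. f j (e m) * y j m)) \<le>
          (\<Sum>m\<in>A. \<Sum>j<N. c j * (norm (y j m) * w k m))"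
        by (rule sum_mono)
      also have "\<dots> = (\<Sum>j<N. c j * (\<Sum>m\<in>A. norm (y j m) * w k m))"
        by (subst sum.swap) (simp add: sum_distrib_left)
      also have "\<dots> \<le> (\<Sum>j<N. c j * snorm W k (y j))"
        using weighted_term_le[OF y k A] c by (intro sum_mono mult_left_mono) auto
      also have "\<dots> \<le> S"
        unfolding S_def using c weighted_term_le[OF y k, of "{}"]
        by (intro sum_le_suminf[OF s]) auto
      finally show ?thesis .
    qed
    then show "\<exists>M. \<forall>N\<ge>M. (\<Sum>m\<in>A. w k m / w l m * norm (\<Sum>j<N. f j (e m) * y j m)) \<le> S"
      by blast
  qed
  have "(\<lambda>n. w k n / w l n) summable_on {1..}"
  proof (rule nonneg_bdd_above_summable_on)
    show "bdd_above (sum (\<lambda>n. w k n / w l n) ` {F. F \<subseteq> {1..} \<and> finite F})"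
      using bound by (intro bdd_aboveI2[of _ _ S]) simp
  qed (use w_pos in \<open>simp add: less_imp_le\<close>)
  with l show ?thesis by (rule that)
qed

lemma nuclear_weightedI:
  assumes crit: "\<And>k. 1 \<le> k \<Longrightarrow> \<exists>l\<ge>1. (\<lambda>n. w k n / w l n) summable_on {1..}"
  shows "nuclear_space W"
  unfolding nuclear_space_def
proof (intro allI impI)
  fix k :: nat assume k: "1 \<le> k"
  from crit[OF k] obtain l where l: "1 \<le> l" and s: "(\<lambda>n. w k n / w l n) summable_on {1..}" by blast
  define f :: "nat \<Rightarrow> (nat \<Rightarrow> 'a) \<Rightarrow> 'a" where "f j x = x (Suc j)" for j x
  define y where "y j = (\<lambda>n. if n = Suc j then (1::'a) else 0)" for j
  define c where "c j = 1 / w l (Suc j)" for j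
  have 1: "linear_form W (f j) \<and> y j \<in> elems W \<and> 0 \<le> c j \<and>
             (\<forall>x\<in>elems W. norm (f j x) \<le> c j * snorm W l x)" for j
    using weighted_unit(1)[of "Suc j", where c = 1] weighted_term_le[OF _ l, of _ "{Suc j}"] w_pos[of l "Suc j"]
    by (auto simp: linear_form_def f_def y_def c_def field_simps)
  have 2: "summable (\<lambda>j. c j * snorm W k (y j))"
    using nonneg_atLeast1_summable[THEN iffD1, OF _ s] w_pos
      weighted_unit(2)[of "Suc _", where c = 1 and k = k]
    by (simp add: less_imp_le c_def y_def)
  have 3: "(\<lambda>N. snorm W k (\<lambda>n. x n - (\<Sum>j<N. f j x * y j n))) \<longlonglongrightarrow> 0" if x: "x \<in> elems W" for x
  proof -
    define g where "g n = norm (x n) * w k n" for n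
    have g0: "0 \<le> g n" for n using w_pos by (simp add: g_def less_imp_le)
    have gs: "g summable_on {1..}"
      using x k unfolding g_def W_def weighted_space_def by simp
    have sg: "summable (\<lambda>n. g (Suc n))"
      using nonneg_atLeast1_summable[THEN iffD1, OF g0 gs] .
    have "snorm W k (\<lambda>n. x n - (\<Sum>j<N. f j x * y j n)) = (\<Sum>n. g (Suc n)) - (\<Sum>n<N. g (Suc n))" for N
    proof -
      have p: "(\<Sum>j<N. f j x * y j n) = (if n \<in> {1..N} then x n else 0)" for n
      proof (cases n)
        case (Suc m)
        have "(\<Sum>j<N. f j x * y j n) = (\<Sum>j<N. if j = m then x (Suc j) else 0)"
          by (intro sum.cong) (auto simp: f_def y_def Suc)
        then show ?thesis by (simp add: Suc Suc_le_eq)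
      qed (simp add: y_def)
      have t: "norm (x n - (if n \<in> {1..N} then x n else 0)) * w k n = (if n \<in> {1..N} then 0 else g n)" for n
        by (simp add: g_def)
      have "(\<lambda>n. if Suc n \<in> {1..N} then 0 else g (Suc n)) sums ((\<Sum>n. g (Suc n)) - (\<Sum>n<N. g (Suc n)))"
      proof -
        have "(\<lambda>n. if n \<in> {..<N} then g (Suc n) else 0) sums (\<Sum>n<N. g (Suc n))"
          by (rule sums_If_finite_set) simp
        from sums_diff[OF summable_sums[OF sg] this] show ?thesis
          by (rule sums_cong[THEN iffD1, rotated]) auto
      qed
      moreover from this have "(\<lambda>n. if n \<in> {1..N} then 0 else g n) summable_on {1..}"
        using g0 by (subst nonneg_atLeast1_summable) (auto simp: sums_iff)
      ultimately show ?thesis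
        unfolding W_def weighted_space_def seq_space.simps p t
        by (subst nonneg_atLeast1_infsum) (auto simp: sums_iff)
    qed
    moreover have "(\<lambda>N. (\<Sum>n. g (Suc n)) - (\<Sum>n<N. g (Suc n))) \<longlonglongrightarrow> (\<Sum>n. g (Suc n)) - (\<Sum>n. g (Suc n))"
      by (intro tendsto_diff tendsto_const summable_LIMSEQ sg)
    ultimately show ?thesis by simp
  qed
  show "\<exists>l\<ge>1. \<exists>f y c.
        (\<forall>j::nat. linear_form W (f j) \<and> y j \<in> elems W \<and> 0 \<le> c j \<and>
             (\<forall>x\<in>elems W. norm (f j x) \<le> c j * snorm W l x)) \<and>
        summable (\<lambda>j. c j * snorm W k (y j)) \<and>
        (\<forall>x\<in>elems W. (\<lambda>N. snorm W k (\<lambda>n. x n - (\<Sum>j<N. f j x * y j n))) \<longlonglongrightarrow> 0)"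
    using l 1 2 3 by blast
qed

end

theorem Grothendieck_Pietsch:
  assumes "exponent_sequence \<beta>"
  shows "nuclear_space (Lambda_fin \<beta> :: 'a::real_normed_field seq_space) \<longleftrightarrow>
     (\<forall>k\<ge>1. \<exists>l>k. (\<lambda>n. exp (- (1 / real k) * \<beta> n) / exp (- (1 / real l) * \<beta> n)) summable_on {1..})"
    (is "?L \<longleftrightarrow> ?R")
proof
  assume ?R
  show ?L unfolding Lambda_fin_def
  proof (rule nuclear_weightedI)
    show "\<exists>l\<ge>1. (\<lambda>n. exp (- (1 / real k) * \<beta> n) / exp (- (1 / real l) * \<beta> n)) summable_on {1..}"
      if "1 \<le> k" for k
      using \<open>?R\<close> that by (meson le_trans less_imp_le)
  qed simp
next
  assume L: ?L
  show ?R
  proof (intro allI impI)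
    fix k :: nat assume k: "1 \<le> k"
    obtain l where l: "1 \<le> l"
      and s: "(\<lambda>n. exp (- (1 / real k) * \<beta> n) / exp (- (1 / real l) * \<beta> n)) summable_on {1..}"
      using nuclear_weighted_imp[OF _ L[unfolded Lambda_fin_def] k] by auto
    define m where "m = max l (Suc k)"
    have "(\<lambda>n. exp (- (1 / real k) * \<beta> n) / exp (- (1 / real m) * \<beta> n)) summable_on {1..}"
    proof (rule summable_on_comparison_test[OF s])
      fix n :: nat assume "n \<in> {1..}"
      then have "0 \<le> \<beta> n" using assms by (auto simp: exponent_sequence_def)
      moreover have "1 / real m \<le> 1 / real l" using l by (simp add: m_def frac_le)
      ultimately have "exp (- (1 / real l) * \<beta> n) \<le> exp (- (1 / real m) * \<beta> n)"
        using mult_right_mono by fastforce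
      then show "exp (- (1 / real k) * \<beta> n) / exp (- (1 / real m) * \<beta> n) \<le>
          exp (- (1 / real k) * \<beta> n) / exp (- (1 / real l) * \<beta> n)"
        by (intro divide_left_mono) auto
    qed simp
    moreover have "k < m" by (simp add: m_def)
    ultimately show "\<exists>l>k. (\<lambda>n. exp (- (1 / real k) * \<beta> n) / exp (- (1 / real l) * \<beta> n)) summable_on {1..}"
      by blast
  qed
qed

end

theory Submission
  imports Defs
begin

text \<open>
  Stability gives \<open>\<alpha> (j + n - 1) \<le> M (\<alpha> j + \<alpha> n)\<close>, so the Hankel matrix is dominated by a rank-one matrix
  \<open>C exp (p \<alpha> j) exp (p \<alpha> n)\<close>. Since \<open>n \<alpha> n \<le> \<beta> n\<close> eventually, \<open>p \<alpha> j - \<beta> j / k \<le> - \<beta> j / (2 k)\<close> for large \<open>j\<close>,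
  and nuclearity makes \<open>j \<mapsto> exp (p \<alpha> j)\<close> an element of \<open>\<Lambda>\<^sub>1(\<beta>)\<close>. The operator therefore maps the unit ball
  of the \<open>p\<close>-th seminorm into a coordinatewise box spanned by an element of \<open>\<Lambda>\<^sub>1(\<beta>)\<close>, and such boxes are
  precompact because bounded sets of scalars are.
\<close>

section \<open>Bounded sets of scalars are precompact\<close>

text \<open>A fixed point \<open>s\<close> of the map taking \<open>s\<close> to
  \<open>(u + s^2) / 2\<close> satisfies \<open>(1 - s)^2 = 1 - u\<close>. Completeness supplies
  one, because the map contracts a small ball around 0.\<close>

lemma square_one_minus:
  fixes u :: "'a::{real_normed_field,banach}"
  assumes "norm u < 1"
  obtains v where "v\<^sup>2 = 1 - u"
proof -
  define q where "q = norm u"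
  \<comment> \<open>The smaller root of \<open>(q + \<rho>^2) / 2 = \<rho>\<close>: the ball of
    radius \<rho> is mapped into itself, and \<rho> < 1 is also the contraction constant.\<close>
  define \<rho> where "\<rho> = 1 - sqrt (1 - q)"
  have q: "0 \<le> q" "q < 1" using assms by (auto simp: q_def)
  have \<rho>: "0 \<le> \<rho>" "\<rho> < 1" using q by (auto simp: \<rho>_def)
  have "(1 - \<rho>)\<^sup>2 = 1 - q" using q by (simp add: \<rho>_def)
  then have eq: "(q + \<rho>\<^sup>2) / 2 = \<rho>" by (simp add: power2_eq_square algebra_simps)
  have "\<exists>!s\<in>cball 0 \<rho>. (u + s\<^sup>2) / 2 = s"
  proof (rule Banach_fix)
    show "(\<lambda>s. (u + s\<^sup>2) / 2) ` cball 0 \<rho> \<subseteq> cball 0 \<rho>"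
    proof (rule image_subsetI)
      fix s :: 'a assume "s \<in> cball 0 \<rho>"
      then have "(norm s)\<^sup>2 \<le> \<rho>\<^sup>2" by (simp add: power_mono)
      then have "norm (u + s\<^sup>2) \<le> q + \<rho>\<^sup>2"
        using norm_triangle_ineq[of u "s\<^sup>2"] by (simp add: q_def norm_power)
      then show "(u + s\<^sup>2) / 2 \<in> cball 0 \<rho>" using eq by (simp add: norm_divide)
    qed
    show "dist ((u + s\<^sup>2) / 2) ((u + t\<^sup>2) / 2) \<le> \<rho> * dist s t"
      if "s \<in> cball 0 \<rho>" "t \<in> cball 0 \<rho>" for s t
    proof -
      have "(u + s\<^sup>2) / 2 - (u + t\<^sup>2) / 2 = (s + t) / 2 * (s - t)"
        by (simp add: power2_eq_square field_simps)
      moreover have "norm ((s + t) / 2) \<le> \<rho>"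
        using that norm_triangle_ineq[of s t] by (simp add: norm_divide)
      ultimately show ?thesis by (simp only: dist_norm norm_mult mult_right_mono norm_ge_zero)
    qed
  qed (use \<rho> in \<open>auto simp: complete_eq_closed\<close>)
  then obtain s where "(u + s\<^sup>2) / 2 = s" by blast
  then have "u + s\<^sup>2 = 2 * s" by (simp add: field_simps)
  then have "(1 - s)\<^sup>2 = 1 - u" by (simp add: power2_eq_square algebra_simps)
  then show ?thesis by (rule that)
qed

text \<open>Otherwise \<open>(x^2 + y^2) / x^2\<close> has norm less than 1, so that
  \<open>- (y / x)^2\<close> is a square by \<open>square_one_minus\<close>, and hence so is
  -1.\<close>

lemma norm_sum_squares_ge:
  fixes x y :: "'a::{real_normed_field,banach}"
  assumes "\<nexists>i::'a. i\<^sup>2 = -1"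
  shows "norm (x\<^sup>2) \<le> norm (x\<^sup>2 + y\<^sup>2)"
proof (rule ccontr)
  assume less: "\<not> ?thesis"
  then have x: "x \<noteq> 0" and y: "y \<noteq> 0" by auto
  have "norm ((x\<^sup>2 + y\<^sup>2) / x\<^sup>2) < 1" using less x by (simp add: norm_divide)
  then obtain v where "v\<^sup>2 = 1 - (x\<^sup>2 + y\<^sup>2) / x\<^sup>2" by (rule square_one_minus)
  then have "v\<^sup>2 * x\<^sup>2 = - (y\<^sup>2)" using x by (simp add: field_simps)
  then have "(v * x / y)\<^sup>2 = -1" using y by (simp add: power_divide power_mult_distrib)
  with assms show False by blast
qed

section \<open>Gelfand--Mazur by best approximation\<close>

text \<open>\<open>b ^ 2 ^ k - z ^ 2 ^ k\<close> has norm at most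
  \<open>m ^ 2 ^ k * (1 + q ^ 2 ^ k)\<close> with \<open>q = norm z / m < 1\<close>; dividing
  \<open>ge\<close> by \<open>m ^ (2 ^ k - 1)\<close> and letting \<open>k\<close> grow leaves
  \<open>m\<close>. In the application \<open>b\<close> is a shortest difference from the range of
  \<open>h\<close>, and \<open>ge\<close> says that the cofactor of \<open>b - z\<close> is at least
  \<open>m ^ (2 ^ k - 1)\<close> in norm.\<close>

lemma best_approx_power:
  fixes b z :: "'a::real_normed_field"
  assumes m: "0 < m" "norm b = m" and z: "norm z < m"
    and ge: "\<And>k. norm (b - z) * m ^ (2 ^ k - 1) \<le> norm (b ^ 2 ^ k - z ^ 2 ^ k)"
  shows "norm (b - z) \<le> m"
proof (rule LIMSEQ_le_const)
  define q where "q = norm z / m"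
  have q: "0 \<le> q" "q < 1" using m z by (auto simp: q_def)
  have "filterlim (\<lambda>k::nat. (2::nat) ^ k) at_top sequentially"
    by (rule filterlim_subseq) (simp add: strict_mono_def)
  then have "(\<lambda>k. q ^ 2 ^ k) \<longlonglongrightarrow> 0"
    using q by (intro filterlim_compose[OF LIMSEQ_power_zero]) auto
  then show "(\<lambda>k. m * (1 + q ^ 2 ^ k)) \<longlonglongrightarrow> m"
    by (auto intro!: tendsto_eq_intros)
  have "norm (b - z) \<le> m * (1 + q ^ 2 ^ k)" for k
  proof -
    have "norm (b - z) * m ^ (2 ^ k - 1) \<le> norm (b ^ 2 ^ k) + norm (z ^ 2 ^ k)"
      using ge[of k] norm_triangle_ineq4[of "b ^ 2 ^ k" "z ^ 2 ^ k"] by linarith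
    also have "\<dots> = m ^ 2 ^ k * (1 + q ^ 2 ^ k)"
      using m by (simp add: norm_power q_def power_divide algebra_simps)
    also have "m ^ 2 ^ k = m * m ^ (2 ^ k - 1)"
      using power_eq_if[of m "2 ^ k"] by (simp only: power_not_zero) simp
    finally show ?thesis using m by (simp add: mult.assoc mult.left_commute)
  qed
  then show "\<exists>N. \<forall>k\<ge>N. norm (b - z) \<le> m * (1 + q ^ 2 ^ k)" by blast
qed

text \<open>
  If the minimum \<open>m\<close> of \<open>norm (a - h z)\<close> were positive, the power estimate would make every point at
  distance less than \<open>m\<close> from a minimiser a minimiser again; walking along the reals would then
  produce arbitrarily large minimisers.
\<close>

lemma scalars_surj:
  fixes h :: "'b::{real_normed_field,euclidean_space} \<Rightarrow> 'a::real_normed_field"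
  assumes lin: "bounded_linear h" and h1: "h 1 = 1"
    and c: "0 < c" "\<And>z. c * norm z \<le> norm (h z)"
    and ge: "\<And>b m z k. (\<And>z. m \<le> norm (b - h z)) \<Longrightarrow> 0 < m \<Longrightarrow> norm b = m \<Longrightarrow>
        norm (b - h z) * m ^ (2 ^ k - 1) \<le> norm (b ^ 2 ^ k - h z ^ 2 ^ k)"
  shows "surj h"
proof -
  interpret bounded_linear h by (rule lin)
  have "a \<in> range h" for a
  proof (rule ccontr)
    assume a: "a \<notin> range h"
    \<comment> \<open>Outside this radius \<open>norm (h z)\<close> is at least
      \<open>2 * norm a\<close>, so \<open>z\<close> does no better than 0; the minimum over the
      compact ball is therefore global.\<close>
    define R where "R = 2 * norm a / c"
    have R: "0 \<le> R" using c by (simp add: R_def)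
    have "\<exists>z0\<in>cball 0 R. \<forall>z\<in>cball 0 R. norm (a - h z0) \<le> norm (a - h z)"
      using R by (intro continuous_attains_inf continuous_intros continuous_on) auto
    then obtain z0 where z0: "z0 \<in> cball 0 R"
      and min0: "\<And>z. z \<in> cball 0 R \<Longrightarrow> norm (a - h z0) \<le> norm (a - h z)" by blast
    define m where "m = norm (a - h z0)"
    have m: "0 < m" using a by (auto simp: m_def)
    have min: "m \<le> norm (a - h z)" for z
    proof (cases "z \<in> cball 0 R")
      case False
      then have "2 * norm a \<le> c * norm z" using c by (simp add: R_def field_simps)
      then have "norm a \<le> norm (a - h z)"
        using c(2)[of z] norm_triangle_ineq2[of "h z" a] by (simp add: norm_minus_commute)
      moreover have "m \<le> norm a" using min0[of 0] R by (simp add: m_def zero)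
      ultimately show ?thesis by simp
    qed (simp add: min0 m_def)
    \<comment> \<open>Any positive step below \<open>m\<close> would satisfy the hypothesis
      \<open>norm z < m\<close> of \<open>best_approx_power\<close>.\<close>
    define t where "t = m / 2"
    have "norm (a - h (z0 + of_real (real n * t))) = m" for n
    proof (induction n)
      case (Suc n)
      define b where "b = a - h (z0 + of_real (real n * t))"
      have ht: "h (of_real t) = of_real t" using scaleR[of t 1] h1 by (simp add: of_real_def)
      \<comment> \<open>Since \<open>b\<close> differs from \<open>a\<close> by an element of the
        range of \<open>h\<close>, it inherits the lower bound \<open>m\<close> on all distances to
        that range.\<close>
      have b': "b - h z = a - h (z0 + of_real (real n * t) + z)" for z
        by (simp add: b_def add)
      have "norm (b - h (of_real t)) \<le> m"
      proof (rule best_approx_power[OF m])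
        show "norm b = m" using Suc by (simp add: b_def)
        show "norm (h (of_real t)) < m" using m by (simp add: ht) (simp add: t_def)
        show "norm (b - h (of_real t)) * m ^ (2 ^ k - 1) \<le> norm (b ^ 2 ^ k - h (of_real t) ^ 2 ^ k)" for k
          by (rule ge) (use m Suc in \<open>simp_all only: b' min b_def[symmetric]\<close>)
      qed
      moreover have "b - h (of_real t) = a - h (z0 + of_real (real (Suc n) * t))"
        by (simp add: b' algebra_simps)
      ultimately show ?case using min[of "z0 + of_real (real (Suc n) * t)"] by simp
    qed (simp add: m_def)
    \<comment> \<open>Two minimisers have images at most \<open>2 * m\<close> apart, but five steps
      of \<open>m / 2\<close> cover \<open>5 * m / 2\<close>.\<close>
    from this[of 5] have *: "norm (a - h (z0 + of_real (5 * t))) = m" by simp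
    have "h (of_real (5 * t)) = of_real (5 * t)"
      using scaleR[of "5 * t" 1] h1 by (simp add: of_real_def)
    then have "a - h z0 - (a - h (z0 + of_real (5 * t))) = of_real (5 * t)"
      by (simp add: add)
    then have "norm (of_real (5 * t) :: 'a) \<le> m + m"
      using norm_triangle_ineq4[of "a - h z0" "a - h (z0 + of_real (5 * t))"] * by (simp add: m_def)
    then show False using m by (simp add: t_def)
  qed
  then show ?thesis by auto
qed

text \<open>The lower bound confines the preimage of the ball to radius \<open>r / c\<close>, so the
  ball is a closed subset of a compact image.\<close>

lemma compact_cball_of_scalars:
  fixes h :: "'b::euclidean_space \<Rightarrow> 'a::real_normed_vector"
  assumes lin: "bounded_linear h" and c: "0 < c" "\<And>z. c * norm z \<le> norm (h z)" and "surj h"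
  shows "compact (cball (0::'a) r)"
proof -
  have "compact (h ` cball 0 (r / c))"
    by (intro compact_continuous_image linear_continuous_on lin compact_cball)
  moreover have "cball 0 r \<subseteq> h ` cball 0 (r / c)"
  proof
    fix x :: 'a assume x: "x \<in> cball 0 r"
    obtain z where z: "x = h z" using \<open>surj h\<close> by blast
    have "norm z * c \<le> r" using c(2)[of z] x z by (simp add: mult.commute)
    then have "z \<in> cball 0 (r / c)" using c by (simp add: pos_le_divide_eq)
    then show "x \<in> h ` cball 0 (r / c)" using z by blast
  qed
  ultimately show ?thesis
    by (metis closed_cball compact_Int_closed inf.absorb_iff2)
qed

text \<open>Doubling the exponent contributes one new factor, a sum of powers; the inductions below
  only have to bound its norm from below by \<open>m ^ 2 ^ k\<close>.\<close>

lemma power_diff_double: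
  fixes x y :: "'a::comm_ring_1"
  shows "x ^ 2 ^ Suc k - y ^ 2 ^ Suc k = (x ^ 2 ^ k - y ^ 2 ^ k) * (x ^ 2 ^ k + y ^ 2 ^ k)"
proof -
  have "z ^ 2 ^ Suc k = (z ^ 2 ^ k)\<^sup>2" for z :: 'a
    by (simp only: power_Suc2 power_mult)
  then show ?thesis by (simp only: power2_eq_square square_diff_square_factored mult.commute)
qed

lemma power_split_double: "(m::real) ^ (2 ^ Suc k - 1) = m ^ (2 ^ k - 1) * m ^ 2 ^ k"
proof -
  have "(2::nat) ^ Suc k - 1 = (2 ^ k - 1) + 2 ^ k" by simp
  then show ?thesis by (simp only: power_add)
qed

text \<open>
  By the Gelfand--Mazur theorem the scalar field is a copy of the reals or of the complex numbers,
  according to whether \<open>-1\<close> is a square.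
\<close>

lemma compact_cball_scalar:
  "compact (cball (0::'a::{real_normed_field,banach}) r)"
proof (cases "\<exists>i::'a. i\<^sup>2 = -1")
  case True
  then obtain i :: 'a where i: "i\<^sup>2 = -1" by blast
  \<comment> \<open>The field embedding of the complex numbers that sends the imaginary unit to
    \<open>i\<close>.\<close>
  define h :: "complex \<Rightarrow> 'a" where "h z = of_real (Re z) + of_real (Im z) * i" for z
  have ii: "i * i = -1" using i by (simp add: power2_eq_square)
  have ii': "i * (i * w) = - w" for w using ii by (metis mult.assoc mult_minus1)
  have "norm i ^ 2 = 1" using i by (metis norm_minus_cancel norm_one norm_power)
  then have ni: "norm i = 1" by (simp add: power2_eq_1_iff) (metis norm_ge_zero not_one_le_zero neg_0_le_iff_le)
  have mult: "h (y * z) = h y * h z" for y z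
    by (simp add: h_def algebra_simps ii')
  have upper: "norm (h z) \<le> norm z * 2" for z
  proof -
    have "norm (h z) \<le> \<bar>Re z\<bar> + \<bar>Im z\<bar>"
      unfolding h_def by (rule norm_triangle_le) (simp add: norm_mult ni)
    then show ?thesis using abs_Re_le_cmod[of z] abs_Im_le_cmod[of z] by simp
  qed
  have lin: "bounded_linear h"
    by (rule bounded_linear_intro[OF _ _ upper]) (auto simp: h_def algebra_simps scaleR_conv_of_real)
  \<comment> \<open>Multiplicativity turns the upper bound for the conjugate into a lower bound:
    \<open>h z * h (cnj z)\<close> is the scalar \<open>(norm z)^2\<close>.\<close>
  have lower: "1 / 2 * norm z \<le> norm (h z)" for z
  proof (cases "z = 0")
    case False
    have "h z * h (cnj z) = of_real ((norm z)\<^sup>2)"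
      unfolding mult[symmetric] complex_norm_square[symmetric]
      by (simp add: h_def complex_mult_cnj cmod_power2)
    then have "(norm z)\<^sup>2 = norm (h z) * norm (h (cnj z))"
      by (metis norm_mult norm_of_real abs_power2)
    also have "\<dots> \<le> norm (h z) * (norm z * 2)"
      using upper[of "cnj z"] by (intro mult_left_mono) auto
    finally have "norm z * norm z \<le> norm z * (norm (h z) * 2)"
      by (simp add: power2_eq_square algebra_simps)
    then show ?thesis using False by simp
  qed (simp add: h_def)
  have hp: "h (z ^ n) = h z ^ n" for z n
    by (induction n) (simp_all add: mult, simp add: h_def)
  have "surj h"
  proof (rule scalars_surj[OF lin _ _ lower])
    fix b :: 'a and m z k
    assume min: "\<And>z. m \<le> norm (b - h z)" and m: "0 < m"
    \<comment> \<open>The second conjunct strengthens the induction: it bounds the new factor, once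
      this is written as a difference at another point.\<close>
    have plus: "norm (b - h z) * m ^ (2 ^ k - 1) \<le> norm (b ^ 2 ^ k - h z ^ 2 ^ k)
        \<and> (\<forall>z. m ^ 2 ^ k \<le> norm (b ^ 2 ^ k - h z ^ 2 ^ k))" for k
    proof (induction k)
      case (Suc k)
      \<comment> \<open>A \<open>2 ^ k\<close>-th root of -1 turns the sum of powers at
        \<open>z\<close> into a difference of powers at \<open>\<zeta> * z\<close>.\<close>
      have "cis (pi / 2 ^ k) ^ 2 ^ k = -1"
        by (simp add: Complex.DeMoivre)
      then obtain \<zeta> :: complex where "\<zeta> ^ 2 ^ k = -1" ..
      then have plus: "b ^ 2 ^ k + h z ^ 2 ^ k = b ^ 2 ^ k - h (\<zeta> * z) ^ 2 ^ k" for z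
        unfolding hp[symmetric] by (simp add: power_mult_distrib mult) (simp add: h_def)
      show ?case
        unfolding power_diff_double norm_mult power_split_double plus
        using Suc m 
        by (auto simp: mult.assoc[symmetric] intro!: mult_mono)
          (auto simp: mult_2 power_add intro!: mult_mono)
    qed (simp add: min)
    then show "norm (b - h z) * m ^ (2 ^ k - 1) \<le> norm (b ^ 2 ^ k - h z ^ 2 ^ k)" by blast
  qed (simp_all add: h_def)
  with lin lower show ?thesis by (intro compact_cball_of_scalars[of h "1 / 2"]) auto
next
  case False
  have surj: "surj (of_real :: real \<Rightarrow> 'a)"
  proof (rule scalars_surj[where c = 1])
    fix b :: 'a and m t :: real and k
    assume min: "\<And>t. m \<le> norm (b - of_real t)" and m: "0 < m" "norm b = m"
    show "norm (b - of_real t) * m ^ (2 ^ k - 1) \<le> norm (b ^ 2 ^ k - of_real t ^ 2 ^ k)"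
    proof (induction k)
      case (Suc k)
      \<comment> \<open>Without roots of -1 the sum is bounded directly: for \<open>k = 0\<close> it
        is a difference at \<open>- t\<close>, and for larger \<open>k\<close> a sum of two
        squares.\<close>
      have "m ^ 2 ^ k \<le> norm (b ^ 2 ^ k + of_real t ^ 2 ^ k)"
      proof (cases k)
        case 0
        then show ?thesis using min[of "- t"] by simp
      next
        case (Suc l)
        then show ?thesis
          using norm_sum_squares_ge[OF False, of "b ^ 2 ^ l" "of_real t ^ 2 ^ l"] m
          by (simp add: power_mult[symmetric] mult.commute norm_power)
      qed
      with Suc m show ?case
        unfolding power_diff_double norm_mult power_split_double
        by (auto simp: mult.assoc[symmetric] intro!: mult_mono)
    qed simp
  qed (auto simp: bounded_linear_of_real)
  show ?thesis
    by (rule compact_cball_of_scalars[of of_real 1, OF bounded_linear_of_real _ _ surj]) auto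
qed

section \<open>The topology of a weighted sequence space\<close>

text \<open>Index 0 is left out of the monotonicity because \<open>1 / real 0 = 0\<close> makes the
  finite-type weight \<open>w 0 n\<close> equal to 1, an upper bound for the others at
  \<open>n \<ge> 1\<close>.\<close>

locale increasing_weights =
  fixes w :: "nat \<Rightarrow> nat \<Rightarrow> real"
  assumes weight_pos: "0 < w k n"
    and weight_mono: "1 \<le> k \<Longrightarrow> k \<le> l \<Longrightarrow> 1 \<le> n \<Longrightarrow> w k n \<le> w l n"
begin

abbreviation W :: "'a::real_normed_field seq_space" where "W \<equiv> weighted_space w"

definition sball :: "nat \<Rightarrow> (nat \<Rightarrow> 'a::real_normed_field) \<Rightarrow> real \<Rightarrow> (nat \<Rightarrow> 'a) set" where
  "sball k x r = {y \<in> elems W. snorm W k (\<lambda>n. y n - x n) < r}"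

lemma elems_iff:
  "x \<in> elems W \<longleftrightarrow> x 0 = 0 \<and> (\<forall>k\<ge>1. (\<lambda>n. norm (x n) * w k n) summable_on {1..})"
  by (simp add: weighted_space_def)

lemma snorm_eq: "snorm W k x = (\<Sum>\<^sub>\<infinity>n\<in>{1..}. norm (x n) * w k n)"
  by (simp add: weighted_space_def)

lemma elems_summable: "x \<in> elems W \<Longrightarrow> 1 \<le> k \<Longrightarrow> (\<lambda>n. norm (x n) * w k n) summable_on {1..}"
  by (simp add: elems_iff)

lemma elems_zero [simp]: "(\<lambda>n. 0) \<in> elems W"
  by (simp add: elems_iff)

lemma snorm_zero [simp]: "snorm W k (\<lambda>n. 0) = 0"
  by (simp add: snorm_eq)

lemma elems_diff: "x \<in> elems W \<Longrightarrow> y \<in> elems W \<Longrightarrow> (\<lambda>n. x n - y n) \<in> elems W"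
  using weighted_diff[of w x y 1] weight_pos by simp

lemma snorm_nonneg: "0 \<le> snorm W k x"
  unfolding snorm_eq using weight_pos by (intro infsum_nonneg) (simp add: less_imp_le)

lemma norm_le_snorm:
  assumes "x \<in> elems W" "1 \<le> k" "1 \<le> n"
  shows "norm (x n) * w k n \<le> snorm W k x"
  using weighted_term_le[of w x k "{n}"] assms weight_pos by simp

lemma snorm_comparison:
  assumes "g summable_on {1..}" "\<And>n. 1 \<le> n \<Longrightarrow> norm (x n) * w k n \<le> g n"
  shows "(\<lambda>n. norm (x n) * w k n) summable_on {1..}" "snorm W k x \<le> infsum g {1..}"
proof -
  show s: "(\<lambda>n. norm (x n) * w k n) summable_on {1..}"
    using assms weight_pos by (intro summable_on_comparison_test[OF assms(1)]) (auto simp: less_imp_le)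
  show "snorm W k x \<le> infsum g {1..}"
    unfolding snorm_eq using assms by (intro infsum_mono s) auto
qed

lemma snorm_mono:
  assumes "x \<in> elems W" "1 \<le> k" "k \<le> l"
  shows "snorm W k x \<le> snorm W l x"
  unfolding snorm_eq[of l]
  using assms by (intro snorm_comparison(2) elems_summable mult_left_mono weight_mono) auto

lemma snorm_triangle:
  assumes "x \<in> elems W" "y \<in> elems W" "z \<in> elems W" "1 \<le> k"
  shows "snorm W k (\<lambda>n. x n - z n) \<le> snorm W k (\<lambda>n. x n - y n) + snorm W k (\<lambda>n. y n - z n)"
proof -
  have s: "(\<lambda>n. norm (x n - y n) * w k n) summable_on {1..}"
      "(\<lambda>n. norm (y n - z n) * w k n) summable_on {1..}"
    using elems_summable[OF elems_diff] assms by blast+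
  have "snorm W k (\<lambda>n. x n - z n) \<le>
      (\<Sum>\<^sub>\<infinity>n\<in>{1..}. norm (x n - y n) * w k n + norm (y n - z n) * w k n)"
  proof (rule snorm_comparison(2))
    show "norm (x n - z n) * w k n \<le> norm (x n - y n) * w k n + norm (y n - z n) * w k n" for n
      using mult_right_mono[OF norm_triangle_ineq[of "x n - y n" "y n - z n"], of "w k n"]
        weight_pos[of k n] by (simp add: algebra_simps)
  qed (intro summable_on_add s)
  also have "\<dots> = snorm W k (\<lambda>n. x n - y n) + snorm W k (\<lambda>n. y n - z n)"
    unfolding snorm_eq by (rule infsum_add[OF s])
  finally show ?thesis .
qed

section \<open>Open sets and neighbourhoods of zero\<close>

lemma seq_topology_eq:
  "seq_topology W = topology_generated_by {sball k x r |k x r. 1 \<le> k \<and> x \<in> elems W \<and> 0 < r}"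
  unfolding seq_topology_def sball_def ..

lemma openin_sball:
  "1 \<le> k \<Longrightarrow> x \<in> elems W \<Longrightarrow> 0 < r \<Longrightarrow> openin (seq_topology W) (sball k x r)"
  unfolding seq_topology_eq by (rule topology_generated_by_Basis) blast

lemma center_in_sball [simp]: "x \<in> elems W \<Longrightarrow> 0 < r \<Longrightarrow> x \<in> sball k x r"
  by (simp add: sball_def)

lemma topspace_seq_topology [simp]: "topspace (seq_topology W) = elems W"
proof
  show "topspace (seq_topology W) \<subseteq> (elems W :: (nat \<Rightarrow> 'a) set)"
    unfolding seq_topology_eq topology_generated_by_topspace by (auto simp: sball_def)
  show "elems W \<subseteq> topspace (seq_topology (W :: 'a seq_space))"
    using openin_sball[of 1 _ 1] center_in_sball[of _ 1 1] openin_subset by fastforce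
qed

lemma sball_subset:
  assumes "1 \<le> k" "k \<le> l" "x \<in> elems W" "y \<in> sball k x r"
  shows "sball l y (r - snorm W k (\<lambda>n. y n - x n)) \<subseteq> sball k x r"
proof
  fix z assume z: "z \<in> sball l y (r - snorm W k (\<lambda>n. y n - x n))"
  then have "snorm W k (\<lambda>n. z n - y n) \<le> snorm W l (\<lambda>n. z n - y n)"
    using assms by (intro snorm_mono elems_diff) (auto simp: sball_def)
  then show "z \<in> sball k x r"
    using z assms snorm_triangle[of z y x k] by (auto simp: sball_def)
qed

text \<open>The generators form only a subbase. Each contains a ball about each of its points by the
  triangle inequality, and since the seminorms increase, the larger index and smaller radius handle
  an intersection.\<close>

lemma openin_contains_sball:
  assumes "openin (seq_topology W) U" "x \<in> U"
  shows "\<exists>k r. 1 \<le> k \<and> 0 < r \<and> sball k x r \<subseteq> U"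
proof -
  have "generate_topology_on {sball k x r |k x r. 1 \<le> k \<and> x \<in> elems W \<and> 0 < r} U"
    using assms(1) unfolding seq_topology_eq by (rule openin_topology_generated_by)
  then show ?thesis using assms(2)
  proof induction
    case (Int A B)
    then obtain k r l s where k: "1 \<le> k" "0 < r" "sball k x r \<subseteq> A"
      and l: "1 \<le> l" "0 < s" "sball l x s \<subseteq> B" by auto
    have x: "x \<in> elems W"
      using Int.hyps Int.prems openin_subset topspace_seq_topology
      unfolding openin_topology_generated_by_iff[symmetric] seq_topology_eq[symmetric] by blast
    have "sball (max k l) x (min r s) \<subseteq> A \<inter> B"
    proof
      fix z assume z: "z \<in> sball (max k l) x (min r s)"
      have "snorm W i (\<lambda>n. z n - x n) \<le> snorm W (max k l) (\<lambda>n. z n - x n)" if "1 \<le> i" "i \<le> max k l" for i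
        using that z x by (intro snorm_mono elems_diff) (auto simp: sball_def)
      from this[of k] this[of l] k(1) l(1) z have "z \<in> sball k x r \<inter> sball l x s"
        by (auto simp: sball_def)
      then show "z \<in> A \<inter> B" using k l by blast
    qed
    then show ?case using k l by (intro exI[of _ "max k l"] exI[of _ "min r s"]) auto
  next
    case (UN K)
    then show ?case by blast
  next
    case (Basis S)
    then obtain k y r where k: "1 \<le> k" "y \<in> elems W" "S = sball k y r" by blast
    with Basis.prems have "0 < r - snorm W k (\<lambda>n. x n - y n)" by (simp add: sball_def)
    with k Basis.prems sball_subset[OF k(1) order_refl k(2), of x r] show ?case by blast
  qed simp
qed

lemma zero_nbhd_sball: "1 \<le> k \<Longrightarrow> 0 < r \<Longrightarrow> zero_nbhd W (sball k (\<lambda>n. 0) r)"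
  unfolding zero_nbhd_def
  by (intro conjI exI[of _ "sball k (\<lambda>n. 0) r"] openin_sball) (auto simp: sball_def)

lemma zero_nbhd_contains:
  assumes "zero_nbhd W U"
  obtains k r where "1 \<le> k" "0 < r" "\<And>x. x \<in> elems W \<Longrightarrow> snorm W k x < r \<Longrightarrow> x \<in> U"
proof -
  obtain V where V: "openin (seq_topology W) V" "(\<lambda>n. 0) \<in> V" "V \<subseteq> U"
    using assms by (auto simp: zero_nbhd_def)
  from openin_contains_sball[OF V(1,2)] obtain k r
    where "1 \<le> k" "0 < r" "sball k (\<lambda>n. 0) r \<subseteq> V" by blast
  with V(3) show ?thesis by (intro that[of k r]) (auto simp: sball_def)
qed

section \<open>Limits and the Hausdorff property\<close>

lemma limitin_seq_topologyI:
  assumes "\<And>N. f N \<in> elems W" "l \<in> elems W"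
    and lim: "\<And>k. 1 \<le> k \<Longrightarrow> (\<lambda>N. snorm W k (\<lambda>n. f N n - l n)) \<longlonglongrightarrow> 0"
  shows "limitin (seq_topology W) f l sequentially"
  unfolding limitin_def
proof (intro conjI allI impI)
  fix U assume "openin (seq_topology W) U \<and> l \<in> U"
  then obtain k r where k: "1 \<le> k" "0 < r" "sball k l r \<subseteq> U"
    using openin_contains_sball by blast
  from order_tendstoD(2)[OF lim[OF k(1)] k(2)]
  show "\<forall>\<^sub>F N in sequentially. f N \<in> U"
    by eventually_elim (use k(3) assms in \<open>auto simp: sball_def\<close>)
qed (use assms in simp)

text \<open>The first seminorm controls every coordinate from 1 on, and coordinate 0 vanishes by
  membership. This uniqueness gives the \<open>THE\<close> in \<open>hankel_operator\<close> its
  meaning.\<close>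

lemma limitin_seq_topology_unique:
  assumes "limitin (seq_topology W) f x F" "limitin (seq_topology W) f y F" "F \<noteq> bot"
  shows "x = y"
proof
  fix n
  have el: "x \<in> elems W" "y \<in> elems W" using assms by (auto dest: limitin_topspace)
  show "x n = y n"
  proof (cases "n = 0")
    case False
    have "norm (x n - y n) * w 1 n \<le> e" if e: "0 < e" for e
    proof -
      have "\<forall>\<^sub>F i in F. f i \<in> sball 1 z (e/2)" if "limitin (seq_topology W) f z F" "z \<in> elems W" for z
        using that e by (intro limitinD[OF that(1)] openin_sball center_in_sball) auto
      from eventually_conj[OF this[OF assms(1) el(1)] this[OF assms(2) el(2)]]
      have "\<forall>\<^sub>F i in F. f i \<in> sball 1 x (e/2) \<inter> sball 1 y (e/2)" by simp
      then obtain i where i: "f i \<in> sball 1 x (e/2)" "f i \<in> sball 1 y (e/2)"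
        using eventually_happens'[OF assms(3)] by blast
      have "norm (f i n - z n) * w 1 n \<le> e/2" if "f i \<in> sball 1 z (e/2)" "z \<in> elems W" for z
        using norm_le_snorm[OF elems_diff[of "f i" z], of 1 n] that False by (auto simp: sball_def)
      from add_mono[OF this[OF i(1) el(1)] this[OF i(2) el(2)]]
      have "(norm (f i n - x n) + norm (f i n - y n)) * w 1 n \<le> e" by (simp add: algebra_simps)
      moreover have "norm (x n - y n) \<le> norm (f i n - x n) + norm (f i n - y n)"
        using norm_triangle_ineq4[of "f i n - y n" "f i n - x n"] by simp
      ultimately show ?thesis
        using weight_pos[of 1 n] by (meson less_imp_le mult_right_mono order_trans)
    qed
    then have "norm (x n - y n) * w 1 n \<le> 0" by (rule field_le_epsilon[where y = 0, simplified])
    then show ?thesis using weight_pos[of 1 n] by (simp add: mult_le_0_iff)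
  qed (use el in \<open>simp add: elems_iff\<close>)
qed

text \<open>Up to \<open>r / 3\<close> the \<open>k\<close>-th seminorm of the box lives on a finite
  set \<open>F\<close> of coordinates; there, finite nets of a scalar ball are combined into a
  finite grid \<open>A\<close> of finitely supported sequences.\<close>

lemma precompact_in_weighted_box:
  fixes b :: "nat \<Rightarrow> real"
  assumes cpt: "\<And>r. compact (cball (0::'a::real_normed_field) r)"
    and b: "\<And>k. 1 \<le> k \<Longrightarrow> (\<lambda>n. b n * w k n) summable_on {1..}"
    and S: "S \<subseteq> elems W" "\<And>y n. y \<in> S \<Longrightarrow> 1 \<le> n \<Longrightarrow> norm (y n :: 'a) \<le> b n"
  shows "precompact_in W S"
  unfolding precompact_in_def
proof (intro conjI allI impI)
  fix U :: "(nat \<Rightarrow> 'a) set" assume "zero_nbhd W U"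
  then obtain k r where k: "1 \<le> k" "0 < r" and U: "\<And>x. x \<in> elems W \<Longrightarrow> snorm W k x < r \<Longrightarrow> x \<in> U"
    by (rule zero_nbhd_contains) blast
  show "\<exists>A. finite A \<and> A \<subseteq> elems W \<and> (\<forall>y\<in>S. \<exists>a\<in>A. (\<lambda>n. y n - a n) \<in> U)"
  proof (cases "S = {}")
    case False
    then have b0: "0 \<le> b n" if "1 \<le> n" for n
      using S(2) that norm_ge_zero order_trans by (metis ex_in_conv)
    obtain F where F: "finite F" "F \<subseteq> {1..}"
      and tail: "dist (\<Sum>n\<in>F. b n * w k n) (\<Sum>\<^sub>\<infinity>n\<in>{1..}. b n * w k n) \<le> r / 3"
      using infsum_finite_approximation[OF b[OF k(1)], of "r / 3"] k(2) by auto
    \<comment> \<open>Mesh for which the coordinates in \<open>F\<close> contribute at most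
      \<open>r / 3\<close>; the added 1 keeps the denominator positive when \<open>F\<close> is
      empty.\<close>
    define \<delta> where "\<delta> = r / (3 * (1 + (\<Sum>n\<in>F. w k n)))"
    have sF: "0 \<le> (\<Sum>n\<in>F. w k n)" using weight_pos by (intro sum_nonneg) (simp add: less_imp_le)
    then have \<delta>: "0 < \<delta>" using k by (simp add: \<delta>_def)
    have \<delta>F: "(\<Sum>n\<in>F. \<delta> * w k n) \<le> r / 3"
      unfolding sum_distrib_left[symmetric] using sF k by (simp add: \<delta>_def field_simps)
    define R where "R = (\<Sum>n\<in>F. b n)"
    have R: "b n \<le> R" if "n \<in> F" for n
      unfolding R_def using that F b0 by (intro member_le_sum) auto
    obtain B where B: "finite B" "cball (0::'a) R \<subseteq> (\<Union>x\<in>B. ball x \<delta>)"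
      using cpt[of R] \<delta> unfolding compact_eq_totally_bounded by blast
    define A where "A = {f. \<forall>n. (n \<in> F \<longrightarrow> f n \<in> B) \<and> (n \<notin> F \<longrightarrow> f n = 0)}"
    have Ael: "A \<subseteq> elems W"
    proof
      fix a assume a: "a \<in> A"
      then have a0: "a n = 0" if "n \<notin> F" for n using that by (simp add: A_def)
      have "(\<lambda>n. norm (a n) * w l n) summable_on {1..}" for l
        by (rule summable_on_cong_neutral[THEN iffD2, OF _ _ _ summable_on_finite[OF F(1)]])
           (use a0 F in auto)
      moreover have "a 0 = 0" using a0[of 0] F by auto
      ultimately show "a \<in> elems W" by (simp add: elems_iff)
    qed
    have "\<exists>a\<in>A. (\<lambda>n. y n - a n) \<in> U" if y: "y \<in> S" for y
    proof -
      have "\<exists>x\<in>B. norm (y n - x) < \<delta>" if n: "n \<in> F" for n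
      proof -
        have "norm (y n) \<le> b n" using F n by (intro S(2)[OF y]) auto
        then have "y n \<in> cball 0 R" using R[OF n] by simp
        then obtain x where "x \<in> B" "y n \<in> ball x \<delta>" using B(2) by blast
        then show ?thesis by (auto simp: dist_norm norm_minus_commute)
      qed
      then obtain g where g: "\<And>n. n \<in> F \<Longrightarrow> g n \<in> B \<and> norm (y n - g n) < \<delta>" by metis
      define a where "a n = (if n \<in> F then g n else 0)" for n
      have a: "a \<in> A" using g by (auto simp: A_def a_def)
      \<comment> \<open>Majorant of the error: the mesh on \<open>F\<close>, and the whole box off
        \<open>F\<close>, where \<open>a\<close> vanishes.\<close>
      define h where "h n = (if n \<in> F then \<delta> * w k n else b n * w k n)" for n
      have hF: "(h has_sum (\<Sum>n\<in>F. \<delta> * w k n)) F"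
        by (rule has_sum_finiteI[OF F(1)]) (simp add: h_def)
      have bT: "(\<lambda>n. b n * w k n) summable_on ({1..} - F)"
        by (rule summable_on_subset_banach[OF b[OF k(1)]]) auto
      have hT: "(h has_sum (\<Sum>\<^sub>\<infinity>n\<in>{1..} - F. b n * w k n)) ({1..} - F)"
        using has_sum_infsum[OF bT] by (rule has_sum_cong[THEN iffD1, rotated]) (simp add: h_def)
      have un: "F \<union> ({1..} - F) = {1..}" using F by auto
      have h: "(h has_sum ((\<Sum>n\<in>F. \<delta> * w k n) + (\<Sum>\<^sub>\<infinity>n\<in>{1..} - F. b n * w k n))) {1..}"
        using has_sum_Un_disjoint[OF hF hT] un by auto
      have "snorm W k (\<lambda>n. y n - a n) \<le> infsum h {1..}"
      proof (rule snorm_comparison(2))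
        show "h summable_on {1..}" using h by (rule has_sum_imp_summable)
        show "norm (y n - a n) * w k n \<le> h n" if "1 \<le> n" for n
          using S(2)[OF y that] g[of n] weight_pos[of k n]
          by (auto simp: a_def h_def less_imp_le intro!: mult_right_mono)
      qed
      also have "\<dots> = (\<Sum>n\<in>F. \<delta> * w k n) + (\<Sum>\<^sub>\<infinity>n\<in>{1..} - F. b n * w k n)"
        using h by (rule infsumI)
      also have "(\<Sum>\<^sub>\<infinity>n\<in>{1..} - F. b n * w k n) = (\<Sum>\<^sub>\<infinity>n\<in>{1..}. b n * w k n) - (\<Sum>n\<in>F. b n * w k n)"
        using F by (subst infsum_Diff[OF b[OF k(1)]]) auto
      also have "(\<Sum>n\<in>F. \<delta> * w k n) + \<dots> < r"
        using \<delta>F tail k(2) unfolding dist_real_def by linarith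
      finally have "snorm W k (\<lambda>n. y n - a n) < r" .
      then have "(\<lambda>n. y n - a n) \<in> U"
        using y a S(1) Ael by (intro U elems_diff) auto
      with a show ?thesis by blast
    qed
    moreover have "finite A" unfolding A_def by (rule finite_set_of_finite_funs[OF F(1) B(1)])
    ultimately show ?thesis using Ael by blast
  qed blast
qed (rule S)

end

lemma continuous_map_weighted:
  fixes T :: "(nat \<Rightarrow> 'a::real_normed_field) \<Rightarrow> nat \<Rightarrow> 'a"
  assumes "increasing_weights v" "increasing_weights w"
    and lin: "linear_operator (weighted_space v) (weighted_space w) T"
    and bd: "\<And>k. 1 \<le> k \<Longrightarrow> \<exists>p\<ge>1. \<exists>C. \<forall>x\<in>elems (weighted_space v).
      snorm (weighted_space w) k (T x) \<le> C * snorm (weighted_space v) p x"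
  shows "continuous_map (seq_topology (weighted_space v)) (seq_topology (weighted_space w)) T"
proof -
  interpret E: increasing_weights v by fact
  interpret F: increasing_weights w by fact
  have T: "T x \<in> elems F.W" if "x \<in> elems E.W" for x
    using lin that by (auto simp: linear_operator_def)
  have Tdiff: "T (\<lambda>n. x n - y n) = (\<lambda>n. T x n - T y n)" if "x \<in> elems E.W" "y \<in> elems E.W" for x y
  proof -
    have "T (\<lambda>n. u n + y n) = (\<lambda>n. T u n + T y n)" if "u \<in> elems E.W" for u
      using lin that \<open>y \<in> elems E.W\<close> by (simp add: linear_operator_def)
    from this[OF E.elems_diff[OF that]] show ?thesis by (simp add: fun_eq_iff)
  qed
  show ?thesis
    unfolding F.seq_topology_eq
  proof (rule continuous_on_generated_topo)
    fix U :: "(nat \<Rightarrow> 'a) set" assume "U \<in> {F.sball k x r |k x r. 1 \<le> k \<and> x \<in> elems F.W \<and> 0 < r}"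
    then obtain k z r where k: "1 \<le> k" "z \<in> elems F.W" "U = F.sball k z r" by blast
    obtain p C where p: "1 \<le> p"
      and C: "\<And>x. x \<in> elems E.W \<Longrightarrow> snorm F.W k (T x) \<le> C * snorm E.W p x"
      using bd[OF k(1)] by blast
    show "openin (seq_topology E.W) (T -` U \<inter> topspace (seq_topology E.W))"
    proof (subst openin_subopen, intro ballI)
      fix x assume x: "x \<in> T -` U \<inter> topspace (seq_topology E.W)"
      then have xe: "x \<in> elems E.W" and Tx: "T x \<in> F.sball k z r" using k by auto
      define s where "s = r - snorm F.W k (\<lambda>n. T x n - z n)"
      have s: "0 < s" using Tx by (simp add: s_def F.sball_def)
      \<comment> \<open>Replacing \<open>C\<close> by this constant makes the radius
        \<open>s / (\<bar>C\<bar> + 1)\<close> meaningful for every real \<open>C\<close>.\<close>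
      have D: "0 < \<bar>C\<bar> + 1" by simp
      have "T y \<in> F.sball k z r" if y: "y \<in> E.sball p x (s / (\<bar>C\<bar> + 1))" for y
      proof -
        have ye: "y \<in> elems E.W" and d: "snorm E.W p (\<lambda>n. y n - x n) < s / (\<bar>C\<bar> + 1)"
          using y by (auto simp: E.sball_def)
        have "snorm F.W k (\<lambda>n. T y n - T x n) \<le> C * snorm E.W p (\<lambda>n. y n - x n)"
          using C[OF E.elems_diff[OF ye xe]] Tdiff[OF ye xe] by simp
        also have "\<dots> \<le> (\<bar>C\<bar> + 1) * snorm E.W p (\<lambda>n. y n - x n)"
          by (intro mult_right_mono E.snorm_nonneg) simp
        also have "\<dots> < s" using d D by (simp only: pos_less_divide_eq mult.commute)
        finally have "T y \<in> F.sball k (T x) s" using T[OF ye] by (simp add: F.sball_def)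
        then show ?thesis
          using F.sball_subset[OF k(1) order_refl k(2) Tx] by (auto simp: s_def)
      qed
      then have "E.sball p x (s / (\<bar>C\<bar> + 1)) \<subseteq> T -` U \<inter> topspace (seq_topology E.W)"
        using k by (auto simp: E.sball_def)
      moreover have "0 < s / (\<bar>C\<bar> + 1)" using s D by (rule divide_pos_pos)
      ultimately show "\<exists>V. openin (seq_topology E.W) V \<and> x \<in> V \<and> V \<subseteq> T -` U \<inter> topspace (seq_topology E.W)"
        using p xe by (intro exI[of _ "E.sball p x (s / (\<bar>C\<bar> + 1))"] conjI E.openin_sball E.center_in_sball)
    qed
  next
    show "T ` topspace (seq_topology E.W) \<subseteq> \<Union> {F.sball k x r |k x r. 1 \<le> k \<and> x \<in> elems F.W \<and> 0 < r}"
      unfolding topology_generated_by_topspace[symmetric] F.seq_topology_eq[symmetric]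
      using T by auto
  qed
qed

section \<open>Matrices dominated by a rank-one matrix\<close>

lemma infsum_tail_tendsto_0:
  fixes f :: "nat \<Rightarrow> real"
  assumes "f summable_on {1..}"
  shows "(\<lambda>N. infsum f {N<..}) \<longlonglongrightarrow> 0"
proof -
  have "(f has_sum infsum f {1..}) {1..}" using assms by (rule has_sum_infsum)
  then have "((\<lambda>n. f (Suc n)) has_sum infsum f {1..}) UNIV"
    using has_sum_reindex_bij_betw[OF bij_betw_Suc_atLeast1, of f] by simp
  then have "(\<lambda>N. \<Sum>n<N. f (Suc n)) \<longlonglongrightarrow> infsum f {1..}"
    by (auto dest: has_sum_imp_sums simp: sums_def)
  then have "(\<lambda>N. infsum f {1..} - (\<Sum>n=1..N. f n)) \<longlonglongrightarrow> infsum f {1..} - infsum f {1..}"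
    by (intro tendsto_diff tendsto_const) (simp add: sum.atLeast1_atMost_eq)
  moreover have "infsum f {N<..} = infsum f {1..} - (\<Sum>n=1..N. f n)" for N
  proof -
    have "infsum f ({1..} - {1..N}) = infsum f {1..} - infsum f {1..N}"
      using assms by (intro infsum_Diff) auto
    moreover have "{1..} - {1..N} = {N<..}" by auto
    ultimately show ?thesis by simp
  qed
  ultimately show ?thesis by simp
qed

text \<open>\<open>A n\<close> is the image of the \<open>n\<close>-th unit sequence. The factor
  \<open>v p n\<close> is the weight of a domain seminorm, so row \<open>j\<close> is a functional
  of dual norm at most \<open>b j\<close>, while \<open>b\<close> meets the summability conditions
  of the target.\<close>

locale dominated_matrix = E: increasing_weights v + F: increasing_weights w
  for v w :: "nat \<Rightarrow> nat \<Rightarrow> real" +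
  fixes A :: "nat \<Rightarrow> nat \<Rightarrow> 'a::{real_normed_field,banach}" and b :: "nat \<Rightarrow> real" and p :: nat
  assumes p: "1 \<le> p"
    and b_summable: "1 \<le> k \<Longrightarrow> (\<lambda>j. b j * w k j) summable_on {1..}"
    and A_le: "1 \<le> n \<Longrightarrow> 1 \<le> j \<Longrightarrow> norm (A n j) \<le> b j * v p n"
    and A_0: "A n 0 = 0"
begin

definition partial :: "(nat \<Rightarrow> 'a) \<Rightarrow> nat \<Rightarrow> nat \<Rightarrow> 'a" where
  "partial x N = (\<lambda>j. \<Sum>n=1..N. x n * A n j)"

text \<open>Coordinatewise sums give linearity directly; \<open>partial_limitin\<close> identifies
  them with the limit in the target topology.\<close>

definition matrix_op :: "(nat \<Rightarrow> 'a) \<Rightarrow> nat \<Rightarrow> 'a" where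
  "matrix_op x = (\<lambda>j. \<Sum>\<^sub>\<infinity>n\<in>{1..}. x n * A n j)"

lemma b_nonneg: "1 \<le> j \<Longrightarrow> 0 \<le> b j"
  using order_trans[OF norm_ge_zero A_le[of 1 j]] E.weight_pos[of p 1] by (simp add: zero_le_mult_iff)

lemma term_le:
  "1 \<le> n \<Longrightarrow> 1 \<le> j \<Longrightarrow> norm (x n * A n j) \<le> b j * (norm (x n) * v p n)"
  using mult_left_mono[OF A_le[of n j], of "norm (x n)"] by (simp add: norm_mult mult.left_commute)

lemma row_summable:
  assumes "x \<in> elems E.W"
  shows "(\<lambda>n. x n * A n j) summable_on {1..}"
proof (cases "j = 0")
  case False
  have "(\<lambda>n. norm (x n * A n j)) summable_on {1..}"
    using False term_le[of _ j x]
    by (intro summable_on_comparison_test[OF summable_on_cmult_right[OF E.elems_summable[OF assms p]]])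
      auto
  then show ?thesis by (rule abs_summable_summable)
qed (simp add: A_0)

text \<open>A general index set \<open>X\<close> serves both the full row and its tails.\<close>

lemma row_tail_le:
  assumes x: "x \<in> elems E.W" and X: "X \<subseteq> {1..}" and j: "1 \<le> j"
  shows "norm (\<Sum>\<^sub>\<infinity>n\<in>X. x n * A n j) \<le> b j * (\<Sum>\<^sub>\<infinity>n\<in>X. norm (x n) * v p n)"
proof (rule norm_infsum_le[OF has_sum_infsum has_sum_cmult_right[OF has_sum_infsum]])
  show "(\<lambda>n. x n * A n j) summable_on X" "(\<lambda>n. norm (x n) * v p n) summable_on X"
    using row_summable[OF x] E.elems_summable[OF x p] X by (blast intro: summable_on_subset_banach)+
  show "norm (x n * A n j) \<le> b j * (norm (x n) * v p n)" if "n \<in> X" for n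
    using that X j by (intro term_le) auto
qed

text \<open>The one estimate behind membership, continuity and convergence: \<open>c\<close> is a
  weight for a column, the \<open>p\<close>-th seminorm for an image, and its tail for a
  remainder.\<close>

lemma dominated_elems:
  assumes "y 0 = 0" "\<And>j. 1 \<le> j \<Longrightarrow> norm (y j) \<le> b j * c"
  shows "y \<in> elems F.W"
    and "1 \<le> k \<Longrightarrow> snorm F.W k y \<le> (\<Sum>\<^sub>\<infinity>j\<in>{1..}. b j * w k j) * c"
proof -
  have s: "(\<lambda>j. b j * w k j * c) summable_on {1..}" if "1 \<le> k" for k
    by (intro summable_on_cmult_left b_summable that)
  have le: "norm (y j) * w k j \<le> b j * w k j * c" if "1 \<le> j" for j k
    using mult_right_mono[OF assms(2)[OF that], of "w k j"] F.weight_pos[of k j]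
    by (simp add: mult_ac)
  show "y \<in> elems F.W"
    using F.snorm_comparison(1)[OF s le] assms(1) by (simp add: F.elems_iff)
  show "snorm F.W k y \<le> (\<Sum>\<^sub>\<infinity>j\<in>{1..}. b j * w k j) * c" if "1 \<le> k"
    using F.snorm_comparison(2)[OF s[OF that] le] by (simp add: infsum_cmult_left')
qed

lemma matrix_op_0: "matrix_op x 0 = 0"
  by (simp add: matrix_op_def A_0)

lemma matrix_op_le:
  assumes "x \<in> elems E.W" "1 \<le> j"
  shows "norm (matrix_op x j) \<le> b j * snorm E.W p x"
  unfolding matrix_op_def E.snorm_eq using assms by (intro row_tail_le) auto

lemma unit_in_elems:
  assumes "1 \<le> n"
  shows "A n \<in> elems F.W"
  using A_le assms by (intro dominated_elems(1)[of _ "v p n"] A_0) auto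

lemma linear_operator_matrix_op: "linear_operator E.W F.W matrix_op"
  unfolding linear_operator_def
proof (intro conjI ballI allI)
  fix x y :: "nat \<Rightarrow> 'a" and c :: 'a assume x: "x \<in> elems E.W"
  show "matrix_op x \<in> elems F.W"
    using matrix_op_le[OF x] by (intro dominated_elems(1) matrix_op_0)
  show "matrix_op (\<lambda>n. c * x n) = (\<lambda>n. c * matrix_op x n)"
    by (simp add: matrix_op_def mult.assoc infsum_cmult_right')
  assume y: "y \<in> elems E.W"
  show "matrix_op (\<lambda>n. x n + y n) = (\<lambda>n. matrix_op x n + matrix_op y n)"
    using row_summable[OF x] row_summable[OF y]
    by (simp add: matrix_op_def distrib_right infsum_add)
qed

text \<open>The remainder after \<open>N\<close> terms is dominated by \<open>b\<close> times the
  tail \<open>t N\<close> of the \<open>p\<close>-th seminorm of \<open>x\<close>, a scalar that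
  serves all coordinates and all target seminorms.\<close>

lemma partial_limitin:
  assumes x: "x \<in> elems E.W"
  shows "limitin (seq_topology F.W) (partial x) (matrix_op x) sequentially"
proof (rule F.limitin_seq_topologyI)
  define t where "t N = (\<Sum>\<^sub>\<infinity>n\<in>{N<..}. norm (x n) * v p n)" for N
  have diff0: "partial x N 0 - matrix_op x 0 = 0" for N
    by (simp add: partial_def matrix_op_def A_0)
  have diff: "norm (partial x N j - matrix_op x j) \<le> b j * t N" if j: "1 \<le> j" for N j
  proof -
    have "infsum (\<lambda>n. x n * A n j) ({1..} - {1..N}) = matrix_op x j - partial x N j"
      unfolding matrix_op_def partial_def
      using row_summable[OF x] by (subst infsum_Diff) auto
    moreover have "{1..} - {1..N} = {N<..}" by auto
    ultimately show ?thesis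
      using row_tail_le[OF x, of "{N<..}" j] j
      by (auto simp: t_def norm_minus_commute[of "partial x N j"])
  qed
  show op: "matrix_op x \<in> elems F.W"
    using linear_operator_matrix_op x by (simp add: linear_operator_def)
  show "partial x N \<in> elems F.W" for N
  proof -
    \<comment> \<open>The remainder is in the space by domination; adding back the limit is phrased
      through closure under differences.\<close>
    have "(\<lambda>j. (partial x N j - matrix_op x j) - (0 - matrix_op x j)) \<in> elems F.W"
      by (intro F.elems_diff[OF dominated_elems(1)[OF diff0 diff] F.elems_diff[OF F.elems_zero op]])
    then show ?thesis by simp
  qed
  fix k :: nat assume k: "1 \<le> k"
  show "(\<lambda>N. snorm F.W k (\<lambda>n. partial x N n - matrix_op x n)) \<longlonglongrightarrow> 0"
  proof (rule tendsto_sandwich[where f = "\<lambda>_. 0"])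
    show "(\<lambda>N. (\<Sum>\<^sub>\<infinity>j\<in>{1..}. b j * w k j) * t N) \<longlonglongrightarrow> 0"
      unfolding t_def
      using infsum_tail_tendsto_0[OF E.elems_summable[OF x p]] by (rule tendsto_mult_right_zero)
    show "\<forall>\<^sub>F N in sequentially. snorm F.W k (\<lambda>n. partial x N n - matrix_op x n) \<le>
        (\<Sum>\<^sub>\<infinity>j\<in>{1..}. b j * w k j) * t N"
      by (intro always_eventually allI dominated_elems(2)[OF diff0 diff k])
  qed (auto simp: F.snorm_nonneg)
qed

lemma continuous_map_matrix_op:
  "continuous_map (seq_topology E.W) (seq_topology F.W) matrix_op"
proof (rule continuous_map_weighted[OF E.increasing_weights_axioms F.increasing_weights_axioms
      linear_operator_matrix_op])
  fix k :: nat assume "1 \<le> k"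
  then have "snorm F.W k (matrix_op x) \<le> (\<Sum>\<^sub>\<infinity>j\<in>{1..}. b j * w k j) * snorm E.W p x"
    if "x \<in> elems E.W" for x
    using matrix_op_le[OF that] by (intro dominated_elems(2) matrix_op_0)
  then show "\<exists>p\<ge>1. \<exists>C. \<forall>x\<in>elems E.W. snorm F.W k (matrix_op x) \<le> C * snorm E.W p x"
    using p by blast
qed

text \<open>The unit ball of the single seminorm \<open>p\<close> suffices for all target seminorms,
  because the box bound \<open>b\<close> does not depend on \<open>k\<close>.\<close>

lemma compact_operator_matrix_op: "compact_operator E.W F.W matrix_op"
  unfolding compact_operator_def
proof (intro conjI exI)
  show "linear_operator E.W F.W matrix_op" by (rule linear_operator_matrix_op)
  show "zero_nbhd E.W (E.sball p (\<lambda>n. 0) 1)"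
    by (rule E.zero_nbhd_sball[OF p]) simp
  show "precompact_in F.W (matrix_op ` E.sball p (\<lambda>n. 0) 1)"
  proof (rule F.precompact_in_weighted_box[OF compact_cball_scalar b_summable])
    show "matrix_op ` E.sball p (\<lambda>n. 0) 1 \<subseteq> elems F.W"
      using linear_operator_matrix_op by (auto simp: linear_operator_def E.sball_def)
    fix y and j :: nat assume "y \<in> matrix_op ` E.sball p (\<lambda>n. 0) 1" and j: "1 \<le> j"
    then obtain x where x: "x \<in> elems E.W" "snorm E.W p x < 1" "y = matrix_op x"
      by (auto simp: E.sball_def)
    have "norm (y j) \<le> b j * snorm E.W p x" using matrix_op_le[OF x(1) j] x(3) by simp
    also have "\<dots> \<le> b j * 1" using x(2) b_nonneg[OF j] by (intro mult_left_mono) auto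
    finally show "norm (y j) \<le> b j" by simp
  qed
qed

text \<open>Transfers the results to \<open>hankel_operator\<close>, whose \<open>THE\<close> is
  identified with \<open>matrix_op\<close> only on the domain.\<close>

lemma matrix_op_cong_operator:
  assumes "\<And>x. x \<in> elems E.W \<Longrightarrow> T x = matrix_op x"
  shows "continuous_map (seq_topology E.W) (seq_topology F.W) T" and "compact_operator E.W F.W T"
proof -
  show "continuous_map (seq_topology E.W) (seq_topology F.W) T"
    by (rule continuous_map_eq[OF continuous_map_matrix_op]) (simp add: assms)
  have "matrix_op ` U = T ` U" if "zero_nbhd E.W U" for U
    using that assms by (intro image_cong) (auto simp: zero_nbhd_def)
  moreover have "linear_operator E.W F.W T"
  proof -
    have "(\<lambda>n. x n + y n) \<in> elems E.W" if "x \<in> elems E.W" "y \<in> elems E.W" for x y :: "nat \<Rightarrow> 'a"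
      using E.elems_diff[OF that(1) E.elems_diff[OF E.elems_zero that(2)]] by simp
    moreover have "(\<lambda>n. c * x n) \<in> elems E.W" if "x \<in> elems E.W" for c and x :: "nat \<Rightarrow> 'a"
      using weighted_diff[of v "\<lambda>n. 0" x "- c"] that E.weight_pos by simp
    ultimately show ?thesis
      using linear_operator_matrix_op unfolding linear_operator_def by (simp add: assms)
  qed
  ultimately show "compact_operator E.W F.W T"
    using compact_operator_matrix_op unfolding compact_operator_def by metis
qed

end

section \<open>Hankel operators between power series spaces\<close>

lemma increasing_weights_inf:
  assumes "\<And>n. 1 \<le> n \<Longrightarrow> 0 \<le> \<alpha> n"
  shows "increasing_weights (\<lambda>k n. exp (real k * \<alpha> n))"
  by unfold_locales (auto intro!: mult_right_mono assms)

lemma increasing_weights_fin: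
  assumes "\<And>n. 1 \<le> n \<Longrightarrow> 0 \<le> \<beta> n"
  shows "increasing_weights (\<lambda>k n. exp (- (1 / real k) * \<beta> n))"
proof
  fix k l n :: nat assume "1 \<le> k" "k \<le> l" "1 \<le> n"
  then have "1 / real l * \<beta> n \<le> 1 / real k * \<beta> n"
    by (intro mult_right_mono assms divide_left_mono) auto
  then show "exp (- (1 / real k) * \<beta> n) \<le> exp (- (1 / real l) * \<beta> n)" by simp
qed simp

text \<open>The index \<open>j + n - 1\<close> is at most twice the larger of \<open>j\<close> and
  \<open>n\<close>, so stability applies once, and the larger exponent is at most the sum of
  both.\<close>

lemma hankel_entry_le:
  fixes \<theta> :: "nat \<Rightarrow> 'a::real_normed_field"
  assumes \<alpha>: "exponent_sequence \<alpha>" "stable_sequence \<alpha>" and \<theta>: "shift_seq \<theta> \<in> Lambda_inf_dual \<alpha>"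
  obtains p C where "1 \<le> p" "0 \<le> C"
    "\<And>n j. 1 \<le> n \<Longrightarrow> 1 \<le> j \<Longrightarrow> norm (hankel_unit \<theta> n j) \<le> C * exp (real p * \<alpha> j) * exp (real p * \<alpha> n)"
proof -
  have nonneg: "0 \<le> \<alpha> n" if "1 \<le> n" for n using \<alpha>(1) that by (simp add: exponent_sequence_def)
  have mono: "\<alpha> m \<le> \<alpha> n" if "1 \<le> m" "m \<le> n" for m n
    using \<alpha>(1) that by (auto simp: exponent_sequence_def intro: mono_onD[of "{1..}" \<alpha>])
  obtain M where M: "\<And>n. 1 \<le> n \<Longrightarrow> \<alpha> (2 * n) \<le> M * \<alpha> n"
    using \<alpha>(2) by (auto simp: stable_sequence_def)
  obtain k C where k: "1 \<le> k"
    and C: "\<And>n. 1 \<le> n \<Longrightarrow> norm (shift_seq \<theta> n) * exp (- real k * \<alpha> n) \<le> C"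
    using \<theta> by (auto simp: Lambda_inf_dual_def bdd_above_def)
  have C0: "0 \<le> C" using order_trans[OF _ C[of 1]] by simp
  \<comment> \<open>Rounding \<open>k * \<bar>M\<bar>\<close> up, plus 1, gives a valid seminorm
    index; the absolute value is taken because \<open>M\<close> has no prescribed sign.\<close>
  define p where "p = nat \<lceil>real k * \<bar>M\<bar>\<rceil> + 1"
  have p: "1 \<le> p" "real k * \<bar>M\<bar> \<le> real p" by (auto simp: p_def) linarith
  have "norm (hankel_unit \<theta> n j) \<le> C * exp (real p * \<alpha> j) * exp (real p * \<alpha> n)"
    if n: "1 \<le> n" and j: "1 \<le> j" for n j
  proof -
    have "\<alpha> (j + n - 1) \<le> \<alpha> (2 * max j n)" using n j by (intro mono) auto
    also have "\<dots> \<le> M * \<alpha> (max j n)" using n by (intro M) simp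
    also have "\<dots> \<le> \<bar>M\<bar> * (\<alpha> j + \<alpha> n)"
      using nonneg[OF n] nonneg[OF j] by (intro mult_mono) (auto simp: max_def)
    finally have "real k * \<alpha> (j + n - 1) \<le> real k * (\<bar>M\<bar> * (\<alpha> j + \<alpha> n))"
      by (rule mult_left_mono) simp
    also have "\<dots> \<le> real p * (\<alpha> j + \<alpha> n)"
      using mult_right_mono[OF p(2), of "\<alpha> j + \<alpha> n"] nonneg[OF n] nonneg[OF j] by (simp add: mult.assoc)
    finally have e: "exp (real k * \<alpha> (j + n - 1)) \<le> exp (real p * \<alpha> j) * exp (real p * \<alpha> n)"
      by (simp add: exp_add[symmetric] distrib_left)
    \<comment> \<open>The entry \<open>\<theta> (j + n - 2)\<close> has position
      \<open>j + n - 1\<close> when counted from 1, as in the dual space.\<close>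
    have "hankel_unit \<theta> n j = shift_seq \<theta> (j + n - 1)"
      using n j by (simp add: hankel_unit_def shift_seq_def numeral_2_eq_2)
    then have "norm (hankel_unit \<theta> n j) \<le> C * exp (real k * \<alpha> (j + n - 1))"
      using C[of "j + n - 1"] n j by (simp add: exp_minus field_simps)
    also have "\<dots> \<le> C * (exp (real p * \<alpha> j) * exp (real p * \<alpha> n))"
      using e C0 by (rule mult_left_mono)
    finally show ?thesis by (simp add: mult.assoc)
  qed
  with p(1) C0 show ?thesis by (rule that)
qed

section \<open>Summability of the majorant from nuclearity\<close>

text \<open>The denominators in the Grothendieck--Pietsch quotients are at most 1, so the quotients
  dominate their numerators.\<close>

lemma nuclear_fin_summable:
  assumes \<beta>: "exponent_sequence \<beta>" and nuc: "nuclear_space (Lambda_fin \<beta> :: 'a::real_normed_field seq_space)"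
    and k: "1 \<le> k"
  shows "(\<lambda>n. exp (- (1 / real k) * \<beta> n)) summable_on {1..}"
proof -
  obtain l where "k < l"
    and s: "(\<lambda>n. exp (- (1 / real k) * \<beta> n) / exp (- (1 / real l) * \<beta> n)) summable_on {1..}"
    using nuc[unfolded Grothendieck_Pietsch[OF \<beta>]] k by blast
  show ?thesis
  proof (rule summable_on_comparison_test[OF s])
    fix n :: nat assume "n \<in> {1..}"
    then have "0 \<le> \<beta> n" using \<beta> by (simp add: exponent_sequence_def)
    then show "exp (- (1 / real k) * \<beta> n) \<le> exp (- (1 / real k) * \<beta> n) / exp (- (1 / real l) * \<beta> n)"
      by (simp add: exp_diff[symmetric])
  qed simp
qed

lemma exp_growth_summable:
  assumes \<beta>: "exponent_sequence \<beta>" and nuc: "nuclear_space (Lambda_fin \<beta> :: 'a::real_normed_field seq_space)"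
    and ev: "\<forall>\<^sub>F n in sequentially. real n * \<alpha> n \<le> \<beta> n" and k: "1 \<le> k"
  shows "(\<lambda>n. exp (real p * \<alpha> n) * exp (- (1 / real k) * \<beta> n)) summable_on {1..}" (is "?f summable_on _")
proof -
  obtain N where N: "\<And>n. N \<le> n \<Longrightarrow> real n * \<alpha> n \<le> \<beta> n"
    using ev by (auto simp: eventually_sequentially)
  \<comment> \<open>From here on the growth condition holds and
    \<open>p / n \<le> 1 / (2 * k)\<close>, so half of the decay \<open>\<beta> n / k\<close>
    absorbs \<open>p * \<alpha> n\<close>; the added 1 keeps \<open>n\<close> positive.\<close>
  define N' where "N' = max N (2 * k * p) + 1"
  have "?f summable_on {N'..}"
  proof (rule summable_on_comparison_test)
    show "(\<lambda>n. exp (- (1 / real (2 * k)) * \<beta> n)) summable_on {N'..}"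
      using k
      by (intro summable_on_subset_banach[OF nuclear_fin_summable[OF \<beta> nuc, of "2 * k"]]) (auto simp: N'_def)
    fix n assume "n \<in> {N'..}"
    then have n: "N \<le> n" "1 \<le> n" "2 * k * p \<le> n" by (auto simp: N'_def)
    have \<beta>0: "0 \<le> \<beta> n" using \<beta> n by (simp add: exponent_sequence_def)
    have "real p * \<alpha> n \<le> real p * (\<beta> n / real n)"
      using N[OF n(1)] n(2) by (intro mult_left_mono) (auto simp: field_simps)
    also have "\<dots> = real p / real n * \<beta> n" by simp
    also have "\<dots> \<le> 1 / real (2 * k) * \<beta> n"
    proof (rule mult_right_mono[OF _ \<beta>0])
      have "real (2 * k * p) \<le> real n" using n(3) by (rule of_nat_mono)
      then show "real p / real n \<le> 1 / real (2 * k)" using n k by (simp add: field_simps)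
    qed
    finally have "real p * \<alpha> n + - (1 / real k) * \<beta> n \<le> - (1 / real (2 * k)) * \<beta> n"
      by (simp add: field_simps)
    then show "?f n \<le> exp (- (1 / real (2 * k)) * \<beta> n)"
      by (simp only: exp_add[symmetric] exp_le_cancel_iff)
  qed simp
  moreover have "?f summable_on {1..<N'}" by (rule summable_on_finite) simp
  ultimately have "?f summable_on ({1..<N'} \<union> {N'..})"
    by (intro summable_on_Un_disjoint) auto
  moreover have "{1..<N'} \<union> {N'..} = {1..}" by (auto simp: N'_def)
  ultimately show ?thesis by simp
qed

theorem theorem3p13:
  fixes \<alpha> \<beta> :: "nat \<Rightarrow> real" and \<theta> :: "nat \<Rightarrow> 'a::{real_normed_field, banach}"
  assumes "exponent_sequence \<alpha>" and "stable_sequence \<alpha>"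
    and "exponent_sequence \<beta>" and "nuclear_space (Lambda_fin \<beta> :: 'a seq_space)"
    and "\<forall>\<^sub>F n in sequentially. real n * \<alpha> n \<le> \<beta> n"
    and "shift_seq \<theta> \<in> Lambda_inf_dual \<alpha>"
  shows "hankel_well_defined \<theta> (Lambda_inf \<alpha>) (Lambda_fin \<beta>) \<and>
    continuous_map (seq_topology (Lambda_inf \<alpha>)) (seq_topology (Lambda_fin \<beta>))
      (hankel_operator \<theta> (Lambda_fin \<beta>)) \<and>
    compact_operator (Lambda_inf \<alpha>) (Lambda_fin \<beta>) (hankel_operator \<theta> (Lambda_fin \<beta>))"
proof -
  obtain p C where p: "1 \<le> p" and C: "0 \<le> C"
    and entry: "\<And>n j. 1 \<le> n \<Longrightarrow> 1 \<le> j \<Longrightarrow>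
      norm (hankel_unit \<theta> n j) \<le> C * exp (real p * \<alpha> j) * exp (real p * \<alpha> n)"
    using hankel_entry_le[OF assms(1,2,6)] by blast
  interpret E: increasing_weights "\<lambda>k n. exp (real k * \<alpha> n)"
    using assms(1) by (intro increasing_weights_inf) (simp add: exponent_sequence_def)
  interpret F: increasing_weights "\<lambda>k n. exp (- (1 / real k) * \<beta> n)"
    using assms(3) by (intro increasing_weights_fin) (simp add: exponent_sequence_def)
  interpret dominated_matrix "\<lambda>k n. exp (real k * \<alpha> n)" "\<lambda>k n. exp (- (1 / real k) * \<beta> n)"
    "hankel_unit \<theta>" "\<lambda>j. C * exp (real p * \<alpha> j)" p
  proof
    show "(\<lambda>j. C * exp (real p * \<alpha> j) * exp (- (1 / real k) * \<beta> j)) summable_on {1..}" if "1 \<le> k" for k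
      using summable_on_cmult_right[OF exp_growth_summable[OF assms(3,4,5) that, of p], of C]
      by (simp only: mult.assoc)
  qed (use p entry in \<open>auto simp: hankel_unit_def\<close>)
  have partial_eq: "hankel_partial \<theta> = partial"
    by (simp add: fun_eq_iff hankel_partial_def partial_def)
  \<comment> \<open>The series converges to \<open>matrix_op x\<close>, and the Hausdorff property
    makes this the value chosen by \<open>THE\<close>.\<close>
  have op_eq: "hankel_operator \<theta> (Lambda_fin \<beta>) x = matrix_op x" if "x \<in> elems (Lambda_inf \<alpha>)" for x
    unfolding hankel_operator_def partial_eq
  proof (rule the_equality)
    show lim: "limitin (seq_topology (Lambda_fin \<beta>)) (partial x) (matrix_op x) sequentially"
      using that partial_limitin by (simp add: Lambda_fin_def Lambda_inf_def)
    show "y = matrix_op x"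
      if "limitin (seq_topology (Lambda_fin \<beta>)) (partial x) y sequentially" for y
      using that lim unfolding Lambda_fin_def
      by (rule F.limitin_seq_topology_unique) simp
  qed
  have "hankel_well_defined \<theta> (Lambda_inf \<alpha>) (Lambda_fin \<beta>)"
    unfolding hankel_well_defined_def partial_eq Lambda_fin_def Lambda_inf_def
    using unit_in_elems partial_limitin by blast
  with matrix_op_cong_operator[of "hankel_operator \<theta> (Lambda_fin \<beta>)"] op_eq show ?thesis
    unfolding Lambda_fin_def Lambda_inf_def by blast
qed

end
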